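(* Let $(A,\Lambda)$ be any associative form ring, let $(I,\Gamma)$ and $(J,\Delta)$ be two form ideals of $(A,\Lambda)$, and let $n\ge 3$. Then $[\operatorname{FU}(2n,I,\Gamma),\operatorname{FU}(2n,J,\Delta)]$ is central in $\operatorname{EU}(2n,A,\Lambda)$ modulo $\operatorname{EU}(2n,(I,\Gamma)\circ(J,\Delta))$; in other words, $$\Big[\big[\operatorname{FU}(2n,I,\Gamma),\operatorname{FU}(2n,J,\Delta)\big],\operatorname{EU}(2n,A,\Lambda)\Big]\le\operatorname{EU}(2n,(I,\Gamma)\circ(J,\Delta)).$$
   Context: Form rings. $A$ is an associative ring with $1$ with an involution $a\mapsto\bar a$ (additive, $\overline{ab}=\bar b\,\bar a$, $\bar{\bar a}=a$), and $\lambda\in\operatorname{Cent}(A)$ is fixed with $\lambda\bar\lambda=1$. Put $\Lambda_{\min}=\{c-\lambda\bar c\mid c\in A\}$, $\Lambda_{\max}=\{c\in A\mid c=-\lambda\bar c\}$. A form parameter $\Lambda$ is an additive subgroup with $\Lambda_{\min}\subseteq\Lambda\subseteq\Lambda_{\max}$ and $c\Lambda\bar c\subseteq\Lambda$ for all $c\in A$; then $(A,\Lambda)$ is a form ring. Form ideals. For a two-sided ideal $I$ with $\bar I=I$ put $\Gamma_{\max}(I)=I\cap\Lambda$ and $\Gamma_{\min}(I)=\{a-\lambda\bar a\mid a\in I\}+\langle ac\bar a\mid a\in I,c\in\Lambda\rangle$ ($\langle\cdot\rangle$ = additive subgroup generated). A form ideal $(I,\Gamma)$ consists of such an $I$ and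 an additive subgroup $\Gamma$ with $\Gamma_{\min}(I)\subseteq\Gamma\subseteq\Gamma_{\max}(I)$ and $c\Gamma\bar c\subseteq\Gamma$ for all $c\in A$. The symmetrised product is $(I,\Gamma)\circ(J,\Delta)=(IJ+JI,\ \Gamma_{\min}(IJ+JI)+{}^J\Gamma+{}^I\Delta)$, where ${}^J\Gamma=\langle b\gamma\bar b\mid b\in J,\gamma\in\Gamma\rangle$, ${}^I\Delta=\langle a\delta\bar a\mid a\in I,\delta\in\Delta\rangle$. Elementary transvections. $\Omega=\{1,\dots,n,-n,\dots,-1\}$ indexes rows and columns of $2n\times 2n$ matrices; $\varepsilon(i)$ is the sign of $i$. For $i\ne\pm j$, $c\in A$: $T_{ij}(c)=e+ce_{ij}-\lambda^{(\varepsilon(j)-\varepsilon(i))/2}\bar c\,e_{-j,-i}$. For $c\in\lambda^{-(\varepsilon(i)+1)/2}\Lambda$: $T_{i,-i}(c)=e+ce_{i,-i}$. For a form ideal write $(I,\Gamma)_{ij}=I$ if $i\ne\pm j$ and $(I,\Gamma)_{i,-i}=\lambda^{-(\varepsilon(i)+1)/2}\Gamma$. $\operatorname{EU}(2n,A,\Lambda)$ is generated by all $T_{ij}(c)$, $c\in(A,\Lambda)_{ij}$; $\operatorname{FU}(2n,I,\Gamma)$ is generated by all $T_{ij}(a)$, $a\in(I,\Gamma)_{ij}$; $\operatorname{EU}(2n,I,\Gamma)$ is the normal closure of $\operatorname{FU}(2n,I,\Gamma)$ in $\operatorname{EU}(2n,A,\Lambda)$. Here $[x,y]=xyx^{-1}y^{-1}$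 and $[H,K]$ is the subgroup generated by commutators. *)

theory Defs
  imports
    "HOL-Algebra.Generated_Groups"
    "HOL-Computational_Algebra.Group_Closure"
    "HOL-Library.Set_Algebras"
    "Jordan_Normal_Form.Matrix"
begin

section \<open>Form rings\<close>

text \<open>
  The sort \<open>{ring, monoid_mult}\<close> is that of associative rings with one; unlike \<open>ring_1\<close> it
  does not exclude the zero ring. Throughout, \<open>bar\<close> is the involution, \<open>lam\<close> the element
  \<open>\<lambda>\<close> and \<open>Lam\<close> the form parameter \<open>\<Lambda>\<close>.
\<close>

definition add_subgroup :: "'a::ab_group_add set \<Rightarrow> bool" where
  "add_subgroup S \<longleftrightarrow> 0 \<in> S \<and> (\<forall>x\<in>S. \<forall>y\<in>S. x + y \<in> S) \<and> (\<forall>x\<in>S. - x \<in> S)"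

definition Lambda_min :: "('a::{ring,monoid_mult} \<Rightarrow> 'a) \<Rightarrow> 'a \<Rightarrow> 'a set" where
  "Lambda_min bar lam = {c - lam * bar c | c. True}"

definition Lambda_max :: "('a::{ring,monoid_mult} \<Rightarrow> 'a) \<Rightarrow> 'a \<Rightarrow> 'a set" where
  "Lambda_max bar lam = {c. c = - (lam * bar c)}"

locale form_ring =
  fixes bar :: "'a::{ring,monoid_mult} \<Rightarrow> 'a" and lam :: 'a and Lam :: "'a set"
  assumes bar_add: "bar (a + b) = bar a + bar b"
    and bar_mult: "bar (a * b) = bar b * bar a"
    and bar_bar: "bar (bar a) = a"
    and lam_central: "lam * a = a * lam"
    and lam_bar: "lam * bar lam = 1"
    and Lam_subgroup: "add_subgroup Lam"
    and Lambda_min_le: "Lambda_min bar lam \<subseteq> Lam"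
    and le_Lambda_max: "Lam \<subseteq> Lambda_max bar lam"
    and Lam_conj: "x \<in> Lam \<Longrightarrow> c * x * bar c \<in> Lam"


section \<open>Form ideals\<close>

definition two_sided_ideal :: "'a::{ring,monoid_mult} set \<Rightarrow> bool" where
  "two_sided_ideal I \<longleftrightarrow> add_subgroup I \<and> (\<forall>a\<in>I. \<forall>c. c * a \<in> I \<and> a * c \<in> I)"

definition Gamma_max :: "'a::{ring,monoid_mult} set \<Rightarrow> 'a set \<Rightarrow> 'a set" where
  "Gamma_max Lam I = I \<inter> Lam"

definition Gamma_min ::
    "('a::{ring,monoid_mult} \<Rightarrow> 'a) \<Rightarrow> 'a \<Rightarrow> 'a set \<Rightarrow> 'a set \<Rightarrow> 'a set" where
  "Gamma_min bar lam Lam I =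
     {a - lam * bar a | a. a \<in> I} + group_closure {a * c * bar a | a c. a \<in> I \<and> c \<in> Lam}"

fun form_ideal ::
    "('a::{ring,monoid_mult} \<Rightarrow> 'a) \<Rightarrow> 'a \<Rightarrow> 'a set \<Rightarrow> 'a set \<times> 'a set \<Rightarrow> bool" where
  "form_ideal bar lam Lam (I, Gam) \<longleftrightarrow>
     two_sided_ideal I \<and> bar ` I = I \<and> add_subgroup Gam \<and>
     Gamma_min bar lam Lam I \<subseteq> Gam \<and> Gam \<subseteq> Gamma_max Lam I \<and>
     (\<forall>c. \<forall>x\<in>Gam. c * x * bar c \<in> Gam)"

text \<open>
  \<open>I * J\<close> is the set of products from \<open>Set_Algebras\<close>, so the product of two ideals is its
  additive closure.
\<close>

definition ideal_prod :: "'a::{ring,monoid_mult} set \<Rightarrow> 'a set \<Rightarrow> 'a set" where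
  "ideal_prod I J = group_closure (I * J)"

definition twisted :: "('a::{ring,monoid_mult} \<Rightarrow> 'a) \<Rightarrow> 'a set \<Rightarrow> 'a set \<Rightarrow> 'a set" where
  "twisted bar J Gam = group_closure {b * g * bar b | b g. b \<in> J \<and> g \<in> Gam}"

fun sym_prod ::
    "('a::{ring,monoid_mult} \<Rightarrow> 'a) \<Rightarrow> 'a \<Rightarrow> 'a set \<Rightarrow> 'a set \<times> 'a set \<Rightarrow> 'a set \<times> 'a set
      \<Rightarrow> 'a set \<times> 'a set" where
  "sym_prod bar lam Lam (I, Gam) (J, Del) =
     (ideal_prod I J + ideal_prod J I,
      Gamma_min bar lam Lam (ideal_prod I J + ideal_prod J I)
        + twisted bar J Gam + twisted bar I Del)"


section \<open>Elementary transvections\<close>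

definition Omega :: "nat \<Rightarrow> int set" where
  "Omega n = {i. 1 \<le> \<bar>i\<bar> \<and> \<bar>i\<bar> \<le> int n}"

text \<open>
  Matrices are indexed from 0 in the library; the index set is enumerated in the order
  \<open>1, \<dots>, n, -n, \<dots>, -1\<close>.
\<close>

definition pos :: "nat \<Rightarrow> int \<Rightarrow> nat" where
  "pos n i = (if 0 < i then nat (i - 1) else nat (2 * int n + i))"

definition unit_matrix :: "nat \<Rightarrow> int \<Rightarrow> int \<Rightarrow> 'a::{ring,monoid_mult} mat" where
  "unit_matrix n i j =
     mat (2 * n) (2 * n) (\<lambda>(r, s). if r = pos n i \<and> s = pos n j then 1 else 0)"

text \<open>Integer powers of \<open>\<lambda>\<close>, using that \<open>bar lam\<close> is its inverse.\<close>

definition lam_pow :: "('a::{ring,monoid_mult} \<Rightarrow> 'a) \<Rightarrow> 'a \<Rightarrow> int \<Rightarrow> 'a" where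
  "lam_pow bar lam k = (if 0 \<le> k then lam ^ nat k else bar lam ^ nat (- k))"

definition transvection ::
    "nat \<Rightarrow> ('a::{ring,monoid_mult} \<Rightarrow> 'a) \<Rightarrow> 'a \<Rightarrow> int \<Rightarrow> int \<Rightarrow> 'a \<Rightarrow> 'a mat" where
  "transvection n bar lam i j c =
     (if j = - i then 1\<^sub>m (2 * n) + c \<cdot>\<^sub>m unit_matrix n i (- i)
      else 1\<^sub>m (2 * n) + c \<cdot>\<^sub>m unit_matrix n i j
             - (lam_pow bar lam ((sgn j - sgn i) div 2) * bar c) \<cdot>\<^sub>m unit_matrix n (- j) (- i))"

text \<open>The admissible parameters \<open>(I, \<Gamma>)\<^bsub>ij\<^esub>\<close>, for \<open>i \<noteq> j\<close>.\<close>

fun entries ::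
    "('a::{ring,monoid_mult} \<Rightarrow> 'a) \<Rightarrow> 'a \<Rightarrow> 'a set \<times> 'a set \<Rightarrow> int \<Rightarrow> int \<Rightarrow> 'a set" where
  "entries bar lam (I, Gam) i j =
     (if j = - i then (\<lambda>x. lam_pow bar lam (- ((sgn i + 1) div 2)) * x) ` Gam else I)"


section \<open>Elementary subgroups\<close>

text \<open>
  \<open>ring_mat\<close> would require \<open>semiring_1\<close>, which excludes the zero ring.
\<close>

definition GL :: "nat \<Rightarrow> 'a::{ring,monoid_mult} mat monoid" where
  "GL m = units_of \<lparr>carrier = carrier_mat m m, monoid.mult = (*), one = 1\<^sub>m m\<rparr>"

definition comm_subgroup :: "('g, 'b) monoid_scheme \<Rightarrow> 'g set \<Rightarrow> 'g set \<Rightarrow> 'g set" where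
  "comm_subgroup G H K =
     generate G {x \<otimes>\<^bsub>G\<^esub> y \<otimes>\<^bsub>G\<^esub> inv\<^bsub>G\<^esub> x \<otimes>\<^bsub>G\<^esub> inv\<^bsub>G\<^esub> y | x y. x \<in> H \<and> y \<in> K}"

text \<open>The smallest normal subgroup of the subgroup \<open>E\<close> of \<open>G\<close> that contains \<open>H \<subseteq> E\<close>.\<close>

definition normal_closure :: "('g, 'b) monoid_scheme \<Rightarrow> 'g set \<Rightarrow> 'g set \<Rightarrow> 'g set" where
  "normal_closure G E H = (\<lambda>N. N \<lhd> G\<lparr>carrier := E\<rparr>) hull H"

definition FU ::
    "nat \<Rightarrow> ('a::{ring,monoid_mult} \<Rightarrow> 'a) \<Rightarrow> 'a \<Rightarrow> 'a set \<times> 'a set \<Rightarrow> 'a mat set" where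
  "FU n bar lam X = generate (GL (2 * n))
     {transvection n bar lam i j a | i j a.
        i \<in> Omega n \<and> j \<in> Omega n \<and> i \<noteq> j \<and> a \<in> entries bar lam X i j}"

text \<open>\<open>EU(2n, A, \<Lambda>)\<close> is \<open>FU\<close> of the form ideal \<open>(A, \<Lambda>)\<close>.\<close>

definition EU_abs ::
    "nat \<Rightarrow> ('a::{ring,monoid_mult} \<Rightarrow> 'a) \<Rightarrow> 'a \<Rightarrow> 'a set \<Rightarrow> 'a mat set" where
  "EU_abs n bar lam Lam = FU n bar lam (UNIV, Lam)"

definition EU ::
    "nat \<Rightarrow> ('a::{ring,monoid_mult} \<Rightarrow> 'a) \<Rightarrow> 'a \<Rightarrow> 'a set \<Rightarrow> 'a set \<times> 'a set \<Rightarrow> 'a mat set"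
  where
  "EU n bar lam Lam X =
     normal_closure (GL (2 * n)) (EU_abs n bar lam Lam) (FU n bar lam X)"

end

theory Submission
  imports Defs
begin

text \<open>
  Write \<open>e\<^sub>-\<^sub>i = - e\<^sub>i\<close>. The transvection \<open>T\<^sub>i\<^sub>j(c)\<close> is a root element for the root
  \<open>e\<^sub>i - e\<^sub>j\<close> of the system of type \<open>C\<^sub>n\<close>, the long roots being those with \<open>j = - i\<close>. If two roots
  \<open>\<alpha>\<close> and \<open>\<beta>\<close> are not opposite, the Chevalley commutator formula writes
  \<open>[x\<^sub>\<alpha>(a), x\<^sub>\<beta>(b)]\<close> as a product of root elements for roots \<open>p\<alpha> + q\<beta>\<close> with \<open>p, q \<ge> 1\<close>, and the
  symmetrised product is made so that their parameters lie in \<open>(I,\<Gamma>) \<circ> (J,\<Delta>)\<close> when \<open>a\<close> belongs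
  to \<open>(I,\<Gamma>)\<close> and \<open>b\<close> to \<open>(J,\<Delta>)\<close> (lemma \<open>chevalley_non_opposite\<close>).

  Let \<open>N\<close> be a normal subgroup of \<open>EU(2n, A, \<Lambda>)\<close> containing \<open>FU\<close> of the product. By the above,
  modulo \<open>N\<close> the root elements of \<open>(I,\<Gamma>)\<close> commute with those of \<open>(J,\<Delta>)\<close> unless the roots are
  opposite, so only \<open>z = [x, y]\<close> with \<open>x = x\<^sub>\<alpha>(a)\<close>, \<open>y = x\<^sub>-\<^sub>\<alpha>(b)\<close> has to be shown central. Take
  \<open>\<beta> \<noteq> \<plusminus>\<alpha>\<close> and \<open>g = x\<^sub>\<beta>(c)\<close> with \<open>c\<close> arbitrary. The commutator formula, now for
  \<open>(A,\<Lambda>) \<circ> (J,\<Delta>) \<subseteq> (J,\<Delta>)\<close> and \<open>(A,\<Lambda>) \<circ> (I,\<Gamma>) \<subseteq> (I,\<Gamma>)\<close>, shows that \<open>u = [g\<inverse>, y\<inverse>]\<close> is a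
  product of root elements of \<open>(J,\<Delta>)\<close> for roots \<open>p\<beta> - q\<alpha>\<close>, and \<open>v = [g\<inverse>, x\<inverse>]\<close> one of root elements
  of \<open>(I,\<Gamma>)\<close> for roots \<open>p\<beta> + q\<alpha>\<close>. As \<open>\<alpha>\<close> and \<open>\<beta>\<close> are not proportional and \<open>p \<ge> 1\<close>, no opposite
  roots occur between \<open>x\<close> and \<open>u\<close>, between \<open>v\<close> and \<open>y\<close>, or between \<open>v\<close> and \<open>u\<close>; so these pairs
  commute modulo \<open>N\<close>, both \<open>xy\<close> and \<open>yx\<close> conjugate \<open>g\<close> to \<open>guv\<close>, and \<open>z\<close> commutes with \<open>g\<close> (lemmas
  \<open>commutator_commutes_if_conjugates_commute\<close>, \<open>opposite_commutator_commutes\<close>). Since \<open>n \<ge> 3\<close>, the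
  root elements for \<open>\<beta> \<noteq> \<plusminus>\<alpha>\<close> generate \<open>EU(2n, A, \<Lambda>)\<close> (lemma \<open>E_generated_off_axis\<close>), so \<open>z\<close> is
  central modulo \<open>N\<close>.

  Once the commutators of generators are central, commutators are multiplicative in both
  arguments, so all of \<open>[FU(2n, I, \<Gamma>), FU(2n, J, \<Delta>)]\<close> is central modulo \<open>N\<close>. Finally,
  \<open>EU(2n, (I,\<Gamma>) \<circ> (J,\<Delta>))\<close> is the intersection of all such \<open>N\<close>.
\<close>

section \<open>The adjoint of a matrix entry and row operations\<close>

context form_ring
begin

lemma bar_0 [simp]: "bar 0 = 0"
  using bar_add[of 0 0] by simp

lemma bar_minus: "bar (- a) = - bar a"
  using bar_add[of a "- a"] by (simp add: eq_neg_iff_add_eq_0 add.commute)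

lemma bar_1 [simp]: "bar 1 = 1"
  using bar_mult[of "bar 1" 1] by (simp add: bar_bar)

lemma bar_lam_central: "bar lam * a = a * bar lam"
  by (metis bar_bar bar_mult lam_central)

lemma bar_lam_lam: "bar lam * lam = 1"
  using lam_bar lam_central by metis

text \<open>
  The powers of \<open>\<lambda>\<close> in the definition of transvections split as
  \<open>\<lambda>\<^bsup>(\<epsilon>(j) - \<epsilon>(i))/2\<^esup> = weight j \<cdot> (weight i)\<inverse>\<close>, where the inverse of \<open>weight i\<close> is its
  conjugate. In this form signs of indices need not be distinguished in the calculations below.
\<close>

definition weight :: "int \<Rightarrow> 'a" where
  "weight i = (if 0 < i then lam else 1)"

lemma weight_central: "weight i * a = a * weight i"
  by (simp add: weight_def lam_central)

lemma bar_weight_central: "bar (weight i) * a = a * bar (weight i)"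
  by (simp add: weight_def bar_lam_central)

lemma weight_bar_weight: "weight i * bar (weight i) = 1"
  by (simp add: weight_def lam_bar)

lemma bar_weight_weight: "bar (weight i) * weight i = 1"
  by (simp add: weight_def bar_lam_lam)

lemma weight_weight_uminus: "i \<noteq> 0 \<Longrightarrow> weight i * weight (- i) = lam"
  by (simp add: weight_def)

text \<open>
  If \<open>X \<mapsto> X\<^sup>*\<close> is the anti-involution of the matrix ring attached to the form, then
  \<open>(c e\<^sub>i\<^sub>j)\<^sup>* = adj i j c e\<^sub>-\<^sub>j\<^sub>,\<^sub>-\<^sub>i\<close>, so a short transvection is \<open>1 + X - X\<^sup>*\<close> and a long one is
  \<open>1 + X\<close> with \<open>X\<^sup>* = - X\<close>. The identities between row operations below rest only on \<open>adj\<close>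
  being additive, reversing products and being an involution.
\<close>

definition adj :: "int \<Rightarrow> int \<Rightarrow> 'a \<Rightarrow> 'a" where
  "adj i j c = lam_pow bar lam ((sgn j - sgn i) div 2) * bar c"

lemma adj_eq:
  assumes "i \<noteq> 0" "j \<noteq> 0"
  shows "adj i j c = weight j * bar (weight i) * bar c"
  using assms lam_bar
  by (auto simp: adj_def weight_def lam_pow_def sgn_if)

lemma adj_add: "adj i j (a + b) = adj i j a + adj i j b"
  by (simp add: adj_def bar_add distrib_left)

lemma adj_uminus: "adj i j (- a) = - adj i j a"
  by (simp add: adj_def bar_minus)

lemma adj_0 [simp]: "adj i j 0 = 0"
  by (simp add: adj_def)

lemma weight_left_commute: "a * (weight i * b) = weight i * (a * b)"
  by (simp only: mult.assoc[symmetric] weight_central[of i a])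

lemma bar_weight_left_commute: "a * (bar (weight i) * b) = bar (weight i) * (a * b)"
  by (simp only: mult.assoc[symmetric] bar_weight_central[of i a])

lemma bar_weight_weight_cancel: "bar (weight i) * (weight i * a) = a"
  by (simp only: mult.assoc[symmetric] bar_weight_weight mult_1_left)

lemma adj_mult:
  assumes "i \<noteq> 0" "j \<noteq> 0" "k \<noteq> 0"
  shows "adj i k (a * b) = adj j k b * adj i j a"
proof -
  have "adj j k b * adj i j a =
      weight k * (bar (weight j) * (bar b * (weight j * (bar (weight i) * bar a))))"
    using assms by (simp add: adj_eq mult.assoc)
  also have "\<dots> = weight k * (bar (weight i) * (bar b * bar a))"
    by (simp only: weight_left_commute[of "bar b"] bar_weight_weight_cancel
        bar_weight_left_commute[of "bar b"])
  finally show ?thesis using assms by (simp add: adj_eq bar_mult mult.assoc)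
qed

lemma adj_adj:
  assumes "i \<noteq> 0" "j \<noteq> 0"
  shows "adj (- j) (- i) (adj i j c) = c"
proof -
  have "adj (- j) (- i) (adj i j c) =
      weight (- i) * (bar (weight (- j)) * (c * (weight i * bar (weight j))))"
    using assms by (simp add: adj_eq bar_mult bar_bar mult.assoc)
  also have "c * (weight i * bar (weight j)) = weight i * (bar (weight j) * c)"
    by (simp only: weight_left_commute[of c] bar_weight_central)
  also have "weight (- i) * (bar (weight (- j)) * (weight i * (bar (weight j) * c)))
      = (weight (- i) * weight i) * (bar (weight (- j)) * bar (weight j) * c)"
    by (simp only: weight_left_commute[of "bar (weight (- j))"] mult.assoc)
  also have "weight (- i) * weight i = lam"
    using weight_weight_uminus[of "- i"] assms by simp
  also have "bar (weight (- j)) * bar (weight j) = bar lam"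
    using weight_weight_uminus[of j] assms by (simp flip: bar_mult)
  also have "lam * (bar lam * c) = c"
    by (simp add: lam_bar flip: mult.assoc)
  finally show ?thesis .
qed

text \<open>
  The effect of left multiplication by \<open>T\<^sub>i\<^sub>j(c)\<close> on a column indexed by \<open>\<Omega>\<close>. Identities between
  products of transvections are checked as identities between such maps, which avoids
  expanding matrix products.
\<close>

definition row_op :: "int \<Rightarrow> int \<Rightarrow> 'a \<Rightarrow> (int \<Rightarrow> 'a) \<Rightarrow> int \<Rightarrow> 'a" where
  "row_op i j c v = (\<lambda>r. v r + (if r = i then c * v j else 0)
     - (if r = - j \<and> j \<noteq> - i then adj i j c * v (- i) else 0))"

lemma row_op_untouched:
  assumes "r \<noteq> i" "r \<noteq> - j"
  shows "row_op i j c v r = v r"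
  using assms by (simp add: row_op_def)

lemma row_op_row:
  assumes "i \<noteq> 0" "j \<noteq> 0" "i \<noteq> - j"
  shows "row_op i j c v i = v i + c * v j"
  using assms by (auto simp: row_op_def)

lemma row_op_opposite_row:
  assumes "i \<noteq> 0" "j \<noteq> 0" "i \<noteq> - j"
  shows "row_op i j c v (- j) = v (- j) - adj i j c * v (- i)"
  using assms by (auto simp: row_op_def)

lemma row_op_long:
  "row_op i (- i) c v = (\<lambda>r. v r + (if r = i then c * v (- i) else 0))"
  by (simp add: row_op_def)

lemma row_op_short:
  "j \<noteq> - i \<Longrightarrow> row_op i j c v = (\<lambda>r. v r + (if r = i then c * v j else 0)
     - (if r = - j then adj i j c * v (- i) else 0))"
  by (simp add: row_op_def)

lemma row_op_0: "row_op i j 0 v = v"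
  by (simp add: row_op_def fun_eq_iff)

lemma row_op_add:
  assumes "i \<noteq> 0" "j \<noteq> 0" "i \<noteq> j"
  shows "row_op i j a (row_op i j b v) = row_op i j (a + b) v"
proof -
  have untouched: "row_op i j b v j = v j" "row_op i j b v (- i) = v (- i)"
    using assms by (auto intro!: row_op_untouched)
  have "row_op i j a (row_op i j b v) r = row_op i j (a + b) v r" for r
    unfolding row_op_def[of i j a "row_op i j b v"] untouched
    by (cases "j = - i") (simp_all add: row_op_def adj_add algebra_simps)
  then show ?thesis by (rule ext)
qed

lemma row_op_flip:
  assumes "i \<noteq> 0" "j \<noteq> 0" "i \<noteq> j" "j \<noteq> - i"
  shows "row_op i j a v = row_op (- j) (- i) (- adj i j a) v"
  using assms by (simp add: row_op_def adj_uminus adj_adj fun_eq_iff)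

text \<open>
  Neither operation reads a row that the other one changes.
\<close>

lemma row_op_commute:
  assumes "j \<noteq> k" "j \<noteq> - l" "i \<noteq> - k" "i \<noteq> l"
  shows "row_op i j a (row_op k l b v) = row_op k l b (row_op i j a v)"
proof -
  have untouched: "row_op k l b v j = v j" "row_op k l b v (- i) = v (- i)"
    "row_op i j a v l = v l" "row_op i j a v (- k) = v (- k)"
    using assms by (auto intro!: row_op_untouched)
  show ?thesis
    unfolding row_op_def[of i j a "row_op k l b v"] row_op_def[of k l b "row_op i j a v"] untouched
    by (simp add: row_op_def algebra_simps split del: if_split)
qed

lemma row_op_short_short:
  assumes "i \<noteq> 0" "j \<noteq> 0" "k \<noteq> 0" "i \<noteq> j" "i \<noteq> - j" "j \<noteq> k" "j \<noteq> - k" "i \<noteq> k" "i \<noteq> - k"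
  shows "row_op i j a (row_op j k b v) =
    row_op i k (a * b) (row_op j k b (row_op i j a v))" (is "_ = row_op i k _ ?u")
proof -
  let ?v = "row_op i j a v"
  have 1: "row_op j k b v j = v j + b * v k" "row_op j k b v (- i) = v (- i)"
    using assms by (auto intro!: row_op_untouched row_op_row)
  have 2: "?v k = v k" "?v (- i) = v (- i)" "?v (- j) = v (- j) - adj i j a * v (- i)"
    using assms by (auto intro!: row_op_untouched row_op_opposite_row)
  have 3: "?u k = v k" "?u (- i) = v (- i)"
    using assms 2 by (auto simp: row_op_untouched)
  have ne: "j \<noteq> - i" "k \<noteq> - j" "k \<noteq> - i" using assms by auto
  show ?thesis
    unfolding row_op_short[OF ne(3), of _ ?u] row_op_short[OF ne(1), of _ "row_op j k b v"]
    unfolding 1 3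
    unfolding row_op_short[OF ne(2), of _ ?v]
    unfolding 2 adj_mult[OF assms(1-3)]
    using ne assms by (auto simp add: row_op_short fun_eq_iff algebra_simps)
qed

lemma row_op_short_short_long:
  assumes "i \<noteq> 0" "j \<noteq> 0" "i \<noteq> j" "i \<noteq> - j"
  shows "row_op i j a (row_op j (- i) b v) =
    row_op i (- i) (a * b - adj i (- i) (a * b)) (row_op j (- i) b (row_op i j a v))"
    (is "_ = row_op i (- i) _ ?u")
proof -
  let ?v = "row_op i j a v"
  have 1: "row_op j (- i) b v j = v j + b * v (- i)" "row_op j (- i) b v (- i) = v (- i)"
    using assms by (auto intro!: row_op_untouched row_op_row)
  have 2: "?v (- i) = v (- i)" "?v (- j) = v (- j) - adj i j a * v (- i)"
    using assms by (auto intro!: row_op_untouched row_op_opposite_row)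
  have 3: "?u (- i) = v (- i)"
    using assms 2 by (auto simp: row_op_untouched)
  have ne: "j \<noteq> - i" "- i \<noteq> - j" and neg: "- i \<noteq> 0" using assms by auto
  show ?thesis
    unfolding row_op_long[of i _ ?u] row_op_short[OF ne(1), of _ "row_op j (- i) b v"]
    unfolding 1 3
    unfolding row_op_short[OF ne(2), of _ ?v]
    unfolding 2 adj_mult[OF assms(1,2) neg]
    using ne assms by (auto simp add: row_op_short fun_eq_iff algebra_simps)
qed

text \<open>
  With \<open>X = a e\<^sub>i\<^sub>,\<^sub>-\<^sub>i\<close> and \<open>Y\<close> the nilpotent part of the second factor, the commutator of
  \<open>1 + X\<close> and \<open>1 + Y\<close> is \<open>1 + XY - YX + YXY\<close>. The first two terms make up the short factor, and
  the cubic one is the long factor.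
\<close>

lemma row_op_long_short:
  assumes "i \<noteq> 0" "j \<noteq> 0" "i \<noteq> j" "i \<noteq> - j" and a: "adj i (- i) a = - a"
  shows "row_op i (- i) a (row_op (- i) j b v) =
    row_op i j (a * b) (row_op (- j) j (- (adj (- i) j b * a * b))
      (row_op (- i) j b (row_op i (- i) a v)))" (is "_ = row_op i j _ (row_op (- j) j _ ?u)")
proof -
  let ?v = "row_op i (- i) a v"
  let ?t = "row_op (- j) j (- (adj (- i) j b * a * b)) ?u"
  have 1: "row_op (- i) j b v (- i) = v (- i) + b * v j"
    using assms by (auto intro!: row_op_row)
  have 2: "?v j = v j" "?v (- i) = v (- i)" "?v i = v i + a * v (- i)"
    using assms by (auto simp: row_op_untouched) (simp add: row_op_long)
  have 3: "?u j = v j" "?u (- i) = v (- i) + b * v j"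
    using assms 2 row_op_row[of "- i" j b ?v] by (auto simp: row_op_untouched)
  have 4: "?t j = v j" "?t (- i) = v (- i) + b * v j"
    using assms 3 by (auto simp: row_op_untouched)
  have ne: "j \<noteq> - i" "j \<noteq> - (- i)" and neg: "- i \<noteq> 0" using assms by auto
  have long: "row_op (- j) j c ?u = (\<lambda>r. ?u r + (if r = - j then c * ?u j else 0))" for c
    using row_op_long[of "- j" c ?u] by (simp only: minus_minus)
  show ?thesis
    unfolding row_op_short[OF ne(1), of _ ?t] row_op_long[of i _ "row_op (- i) j b v"]
    unfolding 1 4
    unfolding long
    unfolding 3
    unfolding row_op_short[OF ne(2), of _ ?v]
    unfolding 2 adj_mult[OF assms(1) neg assms(2)] a
    using ne assms by (auto simp add: row_op_short row_op_long fun_eq_iff algebra_simps)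
qed

end

section \<open>Transvections as matrices\<close>

text \<open>
  The map \<open>pos\<close> is a bijection from \<open>\<Omega>\<close> to the row numbers, so that a matrix is determined by
  its columns read along \<open>\<Omega>\<close>.
\<close>

lemma pos_less: "r \<in> Omega n \<Longrightarrow> pos n r < 2 * n"
  by (auto simp: Omega_def pos_def)

lemma pos_eq_iff: "r \<in> Omega n \<Longrightarrow> s \<in> Omega n \<Longrightarrow> pos n r = pos n s \<longleftrightarrow> r = s"
  by (auto simp: Omega_def pos_def split: if_splits)

lemma pos_surj:
  assumes "k < 2 * n"
  obtains r where "r \<in> Omega n" "k = pos n r"
proof (cases "k < n")
  case True
  then show ?thesis using that[of "int k + 1"] by (auto simp: Omega_def pos_def)
next
  case False
  then show ?thesis using that[of "int k - 2 * int n"] assms by (auto simp: Omega_def pos_def)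
qed

lemma Omega_uminus: "i \<in> Omega n \<Longrightarrow> - i \<in> Omega n"
  by (simp add: Omega_def)

lemma Omega_nonzero: "i \<in> Omega n \<Longrightarrow> i \<noteq> 0"
  by (auto simp: Omega_def)

lemma one_mat_mult_left:
  fixes A :: "'a::{ring,monoid_mult} mat"
  assumes "A \<in> carrier_mat m k"
  shows "1\<^sub>m m * A = A"
proof (rule eq_matI)
  fix i j assume ij: "i < dim_row A" "j < dim_col A"
  then have "(1\<^sub>m m * A) $$ (i, j) = (\<Sum>t<m. (if t = i then 1 else 0) * A $$ (t, j))"
    using assms by (auto simp: scalar_prod_def lessThan_atLeast0 intro!: sum.cong)
  also have "\<dots> = (\<Sum>t<m. (if t = i then A $$ (t, j) else 0))"
    by (rule sum.cong) auto
  finally show "(1\<^sub>m m * A) $$ (i, j) = A $$ (i, j)"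
    using ij assms by (simp add: sum.delta)
qed (use assms in auto)

lemma one_mat_mult_right:
  fixes A :: "'a::{ring,monoid_mult} mat"
  assumes "A \<in> carrier_mat m k"
  shows "A * 1\<^sub>m k = A"
proof (rule eq_matI)
  fix i j assume ij: "i < dim_row A" "j < dim_col A"
  then have "(A * 1\<^sub>m k) $$ (i, j) = (\<Sum>t<k. A $$ (i, t) * (if t = j then 1 else 0))"
    using assms by (auto simp: scalar_prod_def lessThan_atLeast0 intro!: sum.cong)
  also have "\<dots> = (\<Sum>t<k. (if t = j then A $$ (i, t) else 0))"
    by (rule sum.cong) auto
  finally show "(A * 1\<^sub>m k) $$ (i, j) = A $$ (i, j)"
    using ij assms by (simp add: sum.delta)
qed (use assms in auto)

lemma group_GL: "group (GL m :: 'a::{ring,monoid_mult} mat monoid)"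
proof -
  have "Group.monoid \<lparr>carrier = carrier_mat m m, monoid.mult = (*), one = 1\<^sub>m m :: 'a mat\<rparr>"
    by (rule monoidI) (auto simp: one_mat_mult_left one_mat_mult_right)
  then show ?thesis
    unfolding GL_def by (rule monoid.units_group)
qed

lemma mult_GL [simp]: "x \<otimes>\<^bsub>GL m\<^esub> y = x * y"
  by (simp add: GL_def units_of_mult)

lemma one_GL [simp]: "\<one>\<^bsub>GL m\<^esub> = 1\<^sub>m m"
  by (simp add: GL_def units_of_one)

definition column_at :: "nat \<Rightarrow> 'a::zero mat \<Rightarrow> nat \<Rightarrow> int \<Rightarrow> 'a" where
  "column_at n V s = (\<lambda>r. if r \<in> Omega n then V $$ (pos n r, s) else 0)"

lemma mat_eq_by_columns:
  assumes "A \<in> carrier_mat (2 * n) (2 * n)" "B \<in> carrier_mat (2 * n) (2 * n)"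
    and columns: "\<And>s. s < 2 * n \<Longrightarrow> column_at n A s = column_at n B s"
  shows "A = B"
proof (rule eq_matI)
  fix k s assume "k < dim_row B" "s < dim_col B"
  then have "k < 2 * n" "s < 2 * n" using assms by auto
  then obtain r where "r \<in> Omega n" "k = pos n r" by (auto elim: pos_surj)
  then show "A $$ (k, s) = B $$ (k, s)"
    using columns[OF \<open>s < 2 * n\<close>, THEN fun_cong, of r] by (simp add: column_at_def)
qed (use assms in auto)

locale form_ring_rank = form_ring bar lam Lam
  for bar :: "'a::{ring,monoid_mult} \<Rightarrow> 'a" and lam :: 'a and Lam :: "'a set" +
  fixes n :: nat
begin

abbreviation T :: "int \<Rightarrow> int \<Rightarrow> 'a \<Rightarrow> 'a mat" where
  "T \<equiv> transvection n bar lam"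

abbreviation G :: "'a mat monoid" where
  "G \<equiv> GL (2 * n)"

sublocale group G by (rule group_GL)

lemma T_carrier_mat [simp]: "T i j c \<in> carrier_mat (2 * n) (2 * n)"
  by (rule carrier_matI) (simp_all add: transvection_def unit_matrix_def)

lemma if_mult: "(if P then a else b) * c = (if P then a * c else b * c)" for c :: 'a
  by simp

lemma T_entry:
  assumes "p < 2 * n" "t < 2 * n"
  shows "T i j c $$ (p, t) = (if t = p then 1 else 0)
    + (if t = pos n j then if p = pos n i then c else 0 else 0)
    - (if t = pos n (- i) then if p = pos n (- j) \<and> j \<noteq> - i then adj i j c else 0 else 0)"
  using assms by (auto simp: transvection_def unit_matrix_def adj_def)

lemma column_T_mult:
  assumes ij: "i \<in> Omega n" "j \<in> Omega n" and V: "V \<in> carrier_mat (2 * n) (2 * n)"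
    and s: "s < 2 * n"
  shows "column_at n (T i j c * V) s = row_op i j c (column_at n V s)"
proof
  fix r
  note Om = ij ij[THEN Omega_uminus]
  show "column_at n (T i j c * V) s r = row_op i j c (column_at n V s) r"
  proof (cases "r \<in> Omega n")
    case False
    then show ?thesis using Om by (auto simp: column_at_def row_op_def)
  next
    case True
    let ?p = "pos n r"
    have "(T i j c * V) $$ (?p, s) = (\<Sum>t<2 * n. T i j c $$ (?p, t) * V $$ (t, s))"
      using True V s
      by (auto simp: scalar_prod_def lessThan_atLeast0 pos_less transvection_def unit_matrix_def
          intro!: sum.cong)
    also have "\<dots> = (\<Sum>t<2 * n. (if t = ?p then V $$ (t, s) else 0)
        + (if t = pos n j then if ?p = pos n i then c * V $$ (t, s) else 0 else 0)
        - (if t = pos n (- i) then if ?p = pos n (- j) \<and> j \<noteq> - i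
            then adj i j c * V $$ (t, s) else 0 else 0))"
      using True
      by (intro sum.cong refl, subst T_entry)
         (simp_all add: pos_less left_diff_distrib distrib_right if_mult
           cong: if_cong split del: if_split)
    also have "\<dots> = row_op i j c (column_at n V s) r"
      using True Om
      by (simp add: sum.distrib sum_subtractf sum.delta pos_less pos_eq_iff row_op_def column_at_def
          cong: if_cong split del: if_split)
    finally show ?thesis using True by (simp add: column_at_def)
  qed
qed

lemma column_T:
  assumes "i \<in> Omega n" "j \<in> Omega n" "s < 2 * n"
  shows "column_at n (T i j c) s = row_op i j c (column_at n (1\<^sub>m (2 * n)) s)"
  using column_T_mult[of i j "1\<^sub>m (2 * n)" s c] assms
  by (simp add: one_mat_mult_right[where m="2*n" and k="2*n"])

lemma T_zero: "i \<in> Omega n \<Longrightarrow> j \<in> Omega n \<Longrightarrow> T i j 0 = 1\<^sub>m (2 * n)"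
  by (rule mat_eq_by_columns[of _ n]) (simp_all add: column_T row_op_0)

lemma T_add:
  assumes "i \<in> Omega n" "j \<in> Omega n" "i \<noteq> j"
  shows "T i j a * T i j b = T i j (a + b)"
  using assms
  by (intro mat_eq_by_columns[of _ n])
     (simp_all add: column_T column_T_mult row_op_add Omega_nonzero mult_carrier_mat[of _ _ "2 * n"])

lemma T_flip:
  assumes "i \<in> Omega n" "j \<in> Omega n" "i \<noteq> j" "j \<noteq> - i"
  shows "T i j a = T (- j) (- i) (- adj i j a)"
  using assms
  by (intro mat_eq_by_columns[of _ n])
     (simp_all add: column_T Omega_uminus Omega_nonzero row_op_flip[of i j a])

lemma T_commute:
  assumes "i \<in> Omega n" "j \<in> Omega n" "k \<in> Omega n" "l \<in> Omega n"
    and "j \<noteq> k" "j \<noteq> - l" "i \<noteq> - k" "i \<noteq> l"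
  shows "T i j a * T k l b = T k l b * T i j a"
  using assms
  by (intro mat_eq_by_columns[of _ n])
     (simp_all add: column_T column_T_mult row_op_commute[of j k l i] mult_carrier_mat[of _ _ "2 * n"])

lemma T_short_short:
  assumes "i \<in> Omega n" "j \<in> Omega n" "k \<in> Omega n"
    and "i \<noteq> j" "i \<noteq> - j" "j \<noteq> k" "j \<noteq> - k" "i \<noteq> k" "i \<noteq> - k"
  shows "T i j a * T j k b = T i k (a * b) * (T j k b * T i j a)"
  using assms
  by (intro mat_eq_by_columns[of _ n])
     (simp_all add: column_T column_T_mult row_op_short_short[of i j k] Omega_nonzero
       mult_carrier_mat[of _ _ "2 * n"])

lemma T_short_short_long:
  assumes "i \<in> Omega n" "j \<in> Omega n" "i \<noteq> j" "i \<noteq> - j"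
  shows "T i j a * T j (- i) b =
    T i (- i) (a * b - adj i (- i) (a * b)) * (T j (- i) b * T i j a)"
  using assms
  by (intro mat_eq_by_columns[of _ n])
     (simp_all add: column_T column_T_mult row_op_short_short_long[of i j] Omega_nonzero Omega_uminus
       mult_carrier_mat[of _ _ "2 * n"])

lemma T_long_short:
  assumes "i \<in> Omega n" "j \<in> Omega n" "i \<noteq> j" "i \<noteq> - j" "adj i (- i) a = - a"
  shows "T i (- i) a * T (- i) j b =
    T i j (a * b) * T (- j) j (- (adj (- i) j b * a * b)) * (T (- i) j b * T i (- i) a)"
proof -
  have "T i (- i) a * T (- i) j b =
    T i j (a * b) * (T (- j) j (- (adj (- i) j b * a * b)) * (T (- i) j b * T i (- i) a))"
    using assms
    by (intro mat_eq_by_columns[of _ n])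
       (simp_all add: column_T column_T_mult row_op_long_short[of i j] Omega_nonzero Omega_uminus
         mult_carrier_mat[of _ _ "2 * n"])
  also have "\<dots> = T i j (a * b) * T (- j) j (- (adj (- i) j b * a * b)) * (T (- i) j b * T i (- i) a)"
    by (rule assoc_mult_mat[symmetric]) (auto intro!: mult_carrier_mat T_carrier_mat)
  finally show ?thesis .
qed

lemma T_carrier [simp]:
  assumes "i \<in> Omega n" "j \<in> Omega n" "i \<noteq> j"
  shows "T i j c \<in> carrier G"
  unfolding GL_def units_of_carrier Units_def
  using T_add[OF assms, of c "- c"] T_add[OF assms, of "- c" c] T_zero[OF assms(1,2)]
  by (auto intro!: bexI[of _ "T i j (- c)"])

lemma inv_T:
  assumes "i \<in> Omega n" "j \<in> Omega n" "i \<noteq> j"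
  shows "inv\<^bsub>G\<^esub> (T i j c) = T i j (- c)"
  using T_add[OF assms, of "- c" c] assms by (intro inv_equality) (simp_all add: T_zero)

end

section \<open>Admissible parameters and the symmetrised product\<close>

lemma group_closure_subset:
  assumes "add_subgroup K" "S \<subseteq> K"
  shows "group_closure S \<subseteq> K"
proof
  fix x assume "x \<in> group_closure S"
  then show "x \<in> K"
  proof induction
    case (diff s t)
    then have "s + (- t) \<in> K" using assms(1) unfolding add_subgroup_def by blast
    then show ?case by simp
  qed (use assms in \<open>auto simp: add_subgroup_def\<close>)
qed

lemma set_plus_subset:
  assumes "add_subgroup K" "A \<subseteq> K" "B \<subseteq> K"
  shows "A + B \<subseteq> K"
  using assms unfolding add_subgroup_def by (auto elim!: set_plus_elim)

lemma sym_prod_commute: "sym_prod bar lam Lam X Y = sym_prod bar lam Lam Y X"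
  by (cases X; cases Y) (simp add: add.commute add.left_commute)

context form_ring
begin

lemma entries_short: "j \<noteq> - i \<Longrightarrow> entries bar lam X i j = fst X"
  by (cases X) simp

lemma entries_long: "i \<noteq> 0 \<Longrightarrow> entries bar lam X i (- i) = (\<lambda>x. bar (weight i) * x) ` snd X"
  by (cases X) (auto simp: weight_def lam_pow_def)

lemma Lam_eq:
  assumes "x \<in> Lam"
  shows "lam * bar x = - x"
proof -
  have "x = - (lam * bar x)"
    using assms le_Lambda_max unfolding Lambda_max_def by blast
  then show ?thesis by (metis minus_minus)
qed

lemma bar_weight_lam:
  assumes "i \<noteq> 0"
  shows "bar (weight i) * (lam * a) = weight (- i) * a"
proof -
  have "bar (weight i) * (lam * a) = bar (weight i) * (weight i * weight (- i) * a)"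
    by (simp only: weight_weight_uminus[OF assms])
  then show ?thesis by (simp only: mult.assoc bar_weight_weight_cancel)
qed

lemma weight_bar_weight_bar_weight:
  assumes "i \<noteq> 0" "j \<noteq> 0"
  shows "weight j * (bar (weight (- i)) * bar (weight i)) = bar (weight (- j))"
proof -
  have "bar (weight (- i)) * bar (weight i) = bar (weight (- j)) * bar (weight j)"
    using weight_weight_uminus[of i] weight_weight_uminus[of j] assms by (simp flip: bar_mult)
  then show ?thesis
    by (simp only: weight_bar_weight mult_1_right
        weight_left_commute[of "bar (weight (- j))" j "bar (weight j)", symmetric])
qed

lemma adj_bar_weight_mult:
  assumes "i \<noteq> 0"
  shows "adj i (- i) (bar (weight i) * x) = weight (- i) * bar x"
proof -
  have "adj i (- i) (bar (weight i) * x) = weight (- i) * (bar (weight i) * (bar x * weight i))"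
    using assms by (simp add: adj_eq bar_mult bar_bar mult.assoc)
  also have "\<dots> = weight (- i) * bar x"
    by (simp only: weight_central[of i "bar x", symmetric] bar_weight_weight_cancel)
  finally show ?thesis .
qed

text \<open>
  The twist by a power of \<open>\<lambda>\<close> in the admissible long parameters turns the condition
  \<open>x = - \<lambda> bar x\<close> defining \<open>\<Lambda>\<^sub>m\<^sub>a\<^sub>x\<close> into skewness with respect to the adjoint.
\<close>

lemma long_entry_skew:
  assumes "form_ideal bar lam Lam X" "i \<noteq> 0" "a \<in> entries bar lam X i (- i)"
  shows "adj i (- i) a = - a"
proof (cases X)
  case (Pair I Gam)
  then obtain g where g: "g \<in> Lam" "a = bar (weight i) * g"
    using assms by (auto simp: entries_long Gamma_max_def simp del: entries.simps)
  show ?thesis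
    using bar_weight_lam[OF assms(2), of "bar g"] Lam_eq[OF g(1)]
    unfolding g(2) adj_bar_weight_mult[OF assms(2)] by simp
qed

lemma long_entry_in_ideal:
  assumes "form_ideal bar lam Lam X" "i \<noteq> 0" "a \<in> entries bar lam X i (- i)"
  shows "a \<in> fst X"
  using assms by (cases X) (auto simp: entries_long Gamma_max_def two_sided_ideal_def)

lemma entry_uminus:
  assumes "form_ideal bar lam Lam X" "i \<noteq> 0" "a \<in> entries bar lam X i j"
  shows "- a \<in> entries bar lam X i j"
proof (cases "j = - i")
  case True
  then obtain g where "g \<in> snd X" "a = bar (weight i) * g"
    using assms by (auto simp: entries_long)
  moreover have "- g \<in> snd X" if "g \<in> snd X" for g
    using assms(1) that by (cases X) (auto simp: add_subgroup_def)
  ultimately show ?thesis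
    using True assms(2) by (auto simp: entries_long image_iff intro!: bexI[of _ "- g"])
next
  case False
  then show ?thesis
    using assms by (cases X) (auto simp: two_sided_ideal_def add_subgroup_def)
qed

lemma entry_flip:
  assumes "form_ideal bar lam Lam X" "j \<noteq> - i" "a \<in> entries bar lam X i j"
  shows "- adj i j a \<in> entries bar lam X (- j) (- i)"
proof (cases X)
  case (Pair I Gam)
  then have "bar a \<in> I" "\<And>x. x \<in> I \<Longrightarrow> - x \<in> I" "\<And>x c. x \<in> I \<Longrightarrow> c * x \<in> I"
    using assms by (auto simp: two_sided_ideal_def add_subgroup_def)
  then show ?thesis
    using assms(2) Pair by (auto simp: adj_def)
qed

text \<open>
  \<open>(A, \<Lambda>)\<close> itself is a form ideal, so that facts on two form ideals also cover the commutators of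
  relative with absolute root elements.
\<close>

lemma form_ideal_UNIV: "form_ideal bar lam Lam (UNIV, Lam)"
proof -
  have "bar ` UNIV = UNIV" using bar_bar by (metis surjI)
  moreover have "Gamma_min bar lam Lam UNIV \<subseteq> Lam"
    unfolding Gamma_min_def
  proof (rule set_plus_subset[OF Lam_subgroup])
    show "{a - lam * bar a |a. a \<in> UNIV} \<subseteq> Lam"
      using Lambda_min_le by (simp add: Lambda_min_def)
    show "group_closure {a * c * bar a |a c. a \<in> UNIV \<and> c \<in> Lam} \<subseteq> Lam"
      using Lam_conj by (intro group_closure_subset[OF Lam_subgroup]) auto
  qed
  ultimately show ?thesis
    using Lam_subgroup Lam_conj
    by (simp add: two_sided_ideal_def add_subgroup_def Gamma_max_def)
qed

text \<open>
  This is what makes the commutator formula for \<open>(A, \<Lambda>)\<close> and \<open>X\<close> express that elementary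
  conjugation produces only root elements of \<open>X\<close>: every summand of \<open>(A, \<Lambda>) \<circ> (I, \<Gamma>)\<close>
  satisfies a closure property demanded of \<open>\<Gamma>\<close>.
\<close>

lemma sym_prod_UNIV_subset:
  assumes X: "form_ideal bar lam Lam X"
  shows "fst (sym_prod bar lam Lam (UNIV, Lam) X) \<subseteq> fst X"
    and "snd (sym_prod bar lam Lam (UNIV, Lam) X) \<subseteq> snd X"
proof -
  obtain I Gam where [simp]: "X = (I, Gam)" by (cases X)
  have I: "add_subgroup I" "\<And>a c. a \<in> I \<Longrightarrow> c * a \<in> I" "\<And>a c. a \<in> I \<Longrightarrow> a * c \<in> I"
    using X by (auto simp: two_sided_ideal_def)
  have Gam: "add_subgroup Gam" "Gamma_min bar lam Lam I \<subseteq> Gam"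
    "\<And>x c. x \<in> Gam \<Longrightarrow> c * x * bar c \<in> Gam"
    using X by auto
  let ?K = "ideal_prod UNIV I + ideal_prod I UNIV"
  have K: "?K \<subseteq> I"
    unfolding ideal_prod_def using I
    by (intro set_plus_subset group_closure_subset) (auto elim!: set_times_elim)
  have conj: "group_closure {a * c * bar a |a c. a \<in> I \<and> c \<in> Lam} \<subseteq> Gam"
  proof
    fix x assume "x \<in> group_closure {a * c * bar a |a c. a \<in> I \<and> c \<in> Lam}"
    moreover have "0 \<in> {a - lam * bar a |a. a \<in> I}"
      using I(1) by (auto simp: add_subgroup_def intro!: exI[of _ 0])
    ultimately have "0 + x \<in> Gamma_min bar lam Lam I"
      unfolding Gamma_min_def by (rule set_plus_intro[rotated])
    then show "x \<in> Gam" using Gam(2) by auto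
  qed
  have min: "a - lam * bar a \<in> Gam" if "a \<in> I" for a
  proof -
    have "a - lam * bar a + 0 \<in> Gamma_min bar lam Lam I"
      unfolding Gamma_min_def using that by (intro set_plus_intro) auto
    then show ?thesis using Gam(2) by auto
  qed
  have "Gamma_min bar lam Lam ?K \<subseteq> Gam"
    unfolding Gamma_min_def
  proof (rule set_plus_subset[OF Gam(1)])
    show "{a - lam * bar a |a. a \<in> ?K} \<subseteq> Gam" using min K by auto
    have "{a * c * bar a |a c. a \<in> ?K \<and> c \<in> Lam} \<subseteq> {a * c * bar a |a c. a \<in> I \<and> c \<in> Lam}"
      using K by blast
    also have "\<dots> \<subseteq> Gam" using conj by (auto intro: group_closure.base)
    finally show "group_closure {a * c * bar a |a c. a \<in> ?K \<and> c \<in> Lam} \<subseteq> Gam"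
      by (rule group_closure_subset[OF Gam(1)])
  qed
  moreover have "twisted bar I Lam \<subseteq> Gam"
    using conj by (simp add: twisted_def)
  moreover have "twisted bar UNIV Gam \<subseteq> Gam"
    unfolding twisted_def using Gam by (intro group_closure_subset) auto
  ultimately show "snd (sym_prod bar lam Lam (UNIV, Lam) X) \<subseteq> snd X"
    using Gam(1) by (simp add: set_plus_subset)
  show "fst (sym_prod bar lam Lam (UNIV, Lam) X) \<subseteq> fst X"
    using K by simp
qed

context
  fixes X Y :: "'a set \<times> 'a set"
  assumes X: "form_ideal bar lam Lam X" and Y: "form_ideal bar lam Lam Y"
begin

text \<open>
  The parameters produced by the three commutator formulas lie in the symmetrised product:
  short parameters are products, long parameters come from two short roots as
  \<open>x - \<lambda> bar x\<close>, or from a long and a short root as \<open>b \<gamma> bar b\<close>.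
\<close>

lemma mult_in_sym_prod:
  assumes "a \<in> fst X" "b \<in> fst Y"
  shows "a * b \<in> fst (sym_prod bar lam Lam X Y)"
proof -
  obtain I Gam J Del where [simp]: "X = (I, Gam)" "Y = (J, Del)" by (cases X, cases Y)
  have "a * b + 0 \<in> ideal_prod I J + ideal_prod J I"
    using assms by (intro set_plus_intro) (auto simp: ideal_prod_def intro: group_closure.base)
  then show ?thesis by simp
qed

lemma skew_in_sym_prod:
  assumes "i \<noteq> 0" "a \<in> fst X" "b \<in> fst Y"
  shows "a * b - adj i (- i) (a * b) \<in> entries bar lam (sym_prod bar lam Lam X Y) i (- i)"
proof -
  obtain I Gam J Del where XY [simp]: "X = (I, Gam)" "Y = (J, Del)" by (cases X, cases Y)
  \<comment> \<open>The long parameters at \<open>(i, -i)\<close> are \<open>\<Gamma>\<close> divided by \<open>weight i\<close>, so the element of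
    \<open>\<Gamma>\<^sub>m\<^sub>i\<^sub>n\<close> is built from \<open>y\<close> instead of \<open>a * b\<close>.\<close>
  define y where "y = weight i * (a * b)"
  let ?K = "ideal_prod I J + ideal_prod J I"
  have "weight i * a \<in> fst X" using X assms(2) by (simp add: two_sided_ideal_def)
  then have "y \<in> ?K"
    using mult_in_sym_prod[of "weight i * a" b] assms(3) by (simp add: y_def mult.assoc)
  then have "y - lam * bar y + 0 \<in> Gamma_min bar lam Lam ?K"
    unfolding Gamma_min_def by (intro set_plus_intro) auto
  then have "(y - lam * bar y + 0) + 0 + 0 \<in> snd (sym_prod bar lam Lam X Y)"
    unfolding XY sym_prod.simps snd_conv by (intro set_plus_intro) (simp_all add: twisted_def)
  moreover have "a * b - adj i (- i) (a * b) = bar (weight i) * (y - lam * bar y)"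
  proof -
    have "a * b = bar (weight i) * y" by (simp add: y_def bar_weight_weight_cancel)
    moreover have "bar (weight i) * (lam * bar y) = weight (- i) * bar y"
      by (rule bar_weight_lam[OF assms(1)])
    ultimately show ?thesis
      by (simp only: adj_bar_weight_mult[OF assms(1)] right_diff_distrib)
  qed
  ultimately show ?thesis
    unfolding entries_long[OF assms(1)] by (simp del: sym_prod.simps)
qed

lemma conj_in_sym_prod:
  assumes "i \<noteq> 0" "j \<noteq> 0" "a \<in> entries bar lam X i (- i)" "b \<in> fst Y"
  shows "- (adj (- i) j b * a * b) \<in> entries bar lam (sym_prod bar lam Lam X Y) (- j) j"
proof -
  obtain I Gam J Del where XY [simp]: "X = (I, Gam)" "Y = (J, Del)" by (cases X, cases Y)
  obtain g where g: "g \<in> Gam" "a = bar (weight i) * g"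
    using assms(1,3) by (auto simp: entries_long simp del: entries.simps)
  define t where "t = bar b * (- g) * bar (bar b)"
  have "- g \<in> Gam" "bar b \<in> J"
    using g X Y assms(4) by (auto simp: add_subgroup_def)
  then have "t \<in> twisted bar J Gam"
    unfolding t_def twisted_def by (blast intro: group_closure.base)
  moreover have "0 + 0 \<in> Gamma_min bar lam Lam (ideal_prod I J + ideal_prod J I)"
    unfolding Gamma_min_def
  proof (rule set_plus_intro)
    have "0 + 0 \<in> ideal_prod I J + ideal_prod J I"
      by (rule set_plus_intro) (simp_all add: ideal_prod_def)
    then show "0 \<in> {a - lam * bar a |a. a \<in> ideal_prod I J + ideal_prod J I}"
      by (auto intro!: exI[of _ 0])
  qed simp
  ultimately have "(0 + 0) + t + 0 \<in> snd (sym_prod bar lam Lam X Y)"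
    unfolding XY sym_prod.simps snd_conv by (intro set_plus_intro) (simp_all add: twisted_def)
  moreover have "- (adj (- i) j b * a * b) = bar (weight (- j)) * t"
  proof -
    have "adj (- i) j b * a * b = weight j * (bar (weight (- i)) * (bar b * (bar (weight i) * (g * b))))"
      using assms(1,2) by (simp add: adj_eq g mult.assoc)
    also have "\<dots> = weight j * (bar (weight (- i)) * bar (weight i)) * (bar b * (g * b))"
      by (simp only: bar_weight_left_commute[of "bar b"] mult.assoc)
    also have "weight j * (bar (weight (- i)) * bar (weight i)) = bar (weight (- j))"
      by (rule weight_bar_weight_bar_weight[OF assms(1,2)])
    finally show ?thesis by (simp add: t_def bar_bar mult.assoc)
  qed
  ultimately show ?thesis
    using assms(2) entries_long[of "- j" "sym_prod bar lam Lam X Y"]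
    by (auto simp del: sym_prod.simps)
qed

end

end

section \<open>Roots and the commutator formulas\<close>

text \<open>
  The vector \<open>e\<^sub>i - e\<^sub>j\<close>, where \<open>e\<^sub>i\<close> has value 1 at \<open>i\<close> and -1 at \<open>- i\<close>. Coordinates over all
  integers make \<open>e\<^sub>-\<^sub>i = - e\<^sub>i\<close> automatic, and so the two names \<open>(i, j)\<close> and \<open>(-j, -i)\<close> of a
  short root give the same vector.
\<close>

definition root_vec :: "int \<Rightarrow> int \<Rightarrow> int \<Rightarrow> int" where
  "root_vec i j m = of_bool (m = i) - of_bool (m = - i) - of_bool (m = j) + of_bool (m = - j)"

definition cone :: "(int \<Rightarrow> int) \<Rightarrow> (int \<Rightarrow> int) \<Rightarrow> (int \<Rightarrow> int) set" where
  "cone \<alpha> \<beta> = {\<lambda>m. p * \<alpha> m + q * \<beta> m | p q. p \<ge> 1 \<and> q \<ge> 1}"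

lemma root_vec_flip: "root_vec (- j) (- i) = root_vec i j"
  by (simp add: root_vec_def fun_eq_iff)

lemma root_vec_uminus: "root_vec j i m = - root_vec i j m"
  by (simp add: root_vec_def)

lemma coneI:
  assumes "\<And>m. \<gamma> m = p * \<alpha> m + q * \<beta> m" "p \<ge> 1" "q \<ge> 1"
  shows "\<gamma> \<in> cone \<alpha> \<beta>"
  unfolding cone_def using assms by (intro CollectI exI[of _ p] exI[of _ q] conjI ext)

lemma coneE:
  assumes "\<gamma> \<in> cone \<alpha> \<beta>"
  obtains p q where "\<And>m. \<gamma> m = p * \<alpha> m + q * \<beta> m" "p \<ge> 1" "q \<ge> 1"
  using assms that unfolding cone_def by auto

lemma cone_commute: "cone \<alpha> \<beta> = cone \<beta> \<alpha>"
proof -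
  have "\<gamma> \<in> cone \<beta> \<alpha>" if "\<gamma> \<in> cone \<alpha> \<beta>" for \<alpha> \<beta> \<gamma>
    using that by (elim coneE) (rule coneI; simp add: add.commute)
  then show ?thesis by blast
qed

lemma root_vec_eq_0_iff:
  assumes "i \<noteq> 0" "j \<noteq> 0" "i \<noteq> j"
  shows "root_vec i j m = 0 \<longleftrightarrow> \<bar>m\<bar> \<noteq> \<bar>i\<bar> \<and> \<bar>m\<bar> \<noteq> \<bar>j\<bar>"
  using assms by (auto simp: root_vec_def of_bool_def abs_eq_iff split: if_splits)

lemma proportional_roots_aux:
  assumes "i \<noteq> 0" "j \<noteq> 0" "i \<noteq> j" "k \<noteq> l"
    and prp: "\<And>m. p * root_vec k l m = q * root_vec i j m" and p: "p \<ge> 1"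
    and kl: "\<bar>k\<bar> = \<bar>i\<bar>" "\<bar>l\<bar> = \<bar>j\<bar>"
  shows "(k = i \<and> l = j) \<or> (k = - i \<and> l = - j)"
proof (cases "i = - j")
  case True
  then show ?thesis using kl assms(4) by (auto simp: abs_eq_iff)
next
  case False
  have "\<not> (k = i \<and> l = - j)" "\<not> (k = - i \<and> l = j)"
    using prp[of i] prp[of j] False assms(1-3) p by (auto simp: root_vec_def)
  then show ?thesis using kl by (auto simp: abs_eq_iff)
qed

text \<open>
  The root system is reduced. Comparing supports determines the absolute values of the
  indices, and evaluating at \<open>i\<close> and \<open>j\<close> then fixes their signs.
\<close>

lemma proportional_roots:
  assumes ij: "i \<noteq> 0" "j \<noteq> 0" "i \<noteq> j" and kl: "k \<noteq> 0" "l \<noteq> 0" "k \<noteq> l"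
    and prp: "\<And>m. p * root_vec k l m = q * root_vec i j m" and p: "p \<ge> 1"
  shows "(k = i \<and> l = j) \<or> (k = - j \<and> l = - i) \<or> (k = j \<and> l = i) \<or> (k = - i \<and> l = - j)"
proof -
  have "root_vec k l k \<noteq> 0" using kl by (simp add: root_vec_eq_0_iff)
  then have "q \<noteq> 0" using prp[of k] p by auto
  then have "root_vec k l m = 0 \<longleftrightarrow> root_vec i j m = 0" for m
    using prp[of m] p by auto
  then have supp: "\<bar>m\<bar> = \<bar>k\<bar> \<or> \<bar>m\<bar> = \<bar>l\<bar> \<longleftrightarrow> \<bar>m\<bar> = \<bar>i\<bar> \<or> \<bar>m\<bar> = \<bar>j\<bar>" for m
    using ij kl by (simp add: root_vec_eq_0_iff) blast
  have "\<bar>k\<bar> = \<bar>i\<bar> \<and> \<bar>l\<bar> = \<bar>j\<bar> \<or> \<bar>k\<bar> = \<bar>j\<bar> \<and> \<bar>l\<bar> = \<bar>i\<bar>"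
    using supp[of k] supp[of l] supp[of i] supp[of j] by metis
  moreover have "p * root_vec k l m = (- q) * root_vec j i m" for m
    using prp[of m] root_vec_uminus[of i j m] by simp
  ultimately show ?thesis
    using proportional_roots_aux[of i j k l p q] proportional_roots_aux[of j i k l p "- q"]
      ij kl prp p by metis
qed

definition commutator :: "('g, 'b) monoid_scheme \<Rightarrow> 'g \<Rightarrow> 'g \<Rightarrow> 'g" where
  "commutator G x y = x \<otimes>\<^bsub>G\<^esub> y \<otimes>\<^bsub>G\<^esub> inv\<^bsub>G\<^esub> x \<otimes>\<^bsub>G\<^esub> inv\<^bsub>G\<^esub> y"

context group
begin

lemma commutator_closed [simp]:
  "x \<in> carrier G \<Longrightarrow> y \<in> carrier G \<Longrightarrow> commutator G x y \<in> carrier G"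
  by (simp add: commutator_def)

lemma commutator_in_generate:
  assumes "S \<subseteq> carrier G" "x \<in> generate G S" "y \<in> generate G S"
  shows "commutator G x y \<in> generate G S"
  using assms by (simp add: commutator_def generate.eng generate_m_inv_closed)

lemma commutator_eqI:
  assumes "x \<in> carrier G" "y \<in> carrier G" "z \<in> carrier G" "x \<otimes> y = z \<otimes> (y \<otimes> x)"
  shows "commutator G x y = z"
proof -
  have "x \<otimes> y \<otimes> inv x \<otimes> inv y = z \<otimes> (y \<otimes> (x \<otimes> inv x) \<otimes> inv y)"
    using assms by (simp add: m_assoc)
  then show ?thesis using assms by (simp add: commutator_def r_inv)
qed

lemma commutator_alt:
  assumes "x \<in> carrier G" "y \<in> carrier G"
  shows "commutator G x y = x \<otimes> y \<otimes> inv (y \<otimes> x)"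
  using assms by (simp add: commutator_def inv_mult_group m_assoc)

lemma commutator_rel:
  assumes "x \<in> carrier G" "y \<in> carrier G"
  shows "commutator G x y \<otimes> (y \<otimes> x) = x \<otimes> y"
  using assms by (simp add: commutator_alt m_assoc[of _ _ "y \<otimes> x"] del: inv_mult_group)

lemma inv_commutator:
  assumes "x \<in> carrier G" "y \<in> carrier G"
  shows "inv (commutator G x y) = commutator G y x"
  using assms by (simp add: commutator_def inv_mult_group m_assoc)

lemma commutator_eq_one_iff:
  assumes "x \<in> carrier G" "y \<in> carrier G"
  shows "commutator G x y = \<one> \<longleftrightarrow> x \<otimes> y = y \<otimes> x"
  using assms commutator_eqI[of x y \<one>] commutator_rel[of x y] by auto

end

context form_ring_rank
begin

text \<open>
  Root elements whose root is restricted to a set \<open>\<Phi>\<close>. Recording the roots of the factors is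
  what allows opposite roots to be excluded later.
\<close>

definition root_gens :: "'a set \<times> 'a set \<Rightarrow> (int \<Rightarrow> int) set \<Rightarrow> 'a mat set" where
  "root_gens X \<Phi> = {T i j a | i j a. i \<in> Omega n \<and> j \<in> Omega n \<and> i \<noteq> j \<and> root_vec i j \<in> \<Phi>
     \<and> a \<in> entries bar lam X i j}"

lemma root_gens_carrier: "root_gens X \<Phi> \<subseteq> carrier G"
  by (auto simp: root_gens_def)

lemma root_gensI:
  "i \<in> Omega n \<Longrightarrow> j \<in> Omega n \<Longrightarrow> i \<noteq> j \<Longrightarrow> root_vec i j \<in> \<Phi> \<Longrightarrow> a \<in> entries bar lam X i j
    \<Longrightarrow> T i j a \<in> generate G (root_gens X \<Phi>)"
  by (auto simp: root_gens_def intro!: generate.incl)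

lemma FU_eq: "FU n bar lam X = generate G (root_gens X UNIV)"
  by (simp add: FU_def root_gens_def)

text \<open>
  The commutator formula for the roots \<open>(i, j)\<close> and \<open>(k, l)\<close>, forgetting the exact factors.
\<close>

definition chevalley ::
    "'a set \<times> 'a set \<Rightarrow> 'a set \<times> 'a set \<Rightarrow> int \<Rightarrow> int \<Rightarrow> int \<Rightarrow> int \<Rightarrow> bool" where
  "chevalley X Y i j k l \<longleftrightarrow> (\<forall>a \<in> entries bar lam X i j. \<forall>b \<in> entries bar lam Y k l.
     commutator G (T i j a) (T k l b)
       \<in> generate G (root_gens (sym_prod bar lam Lam X Y) (cone (root_vec i j) (root_vec k l))))"

text \<open>
  Inverting a commutator exchanges its arguments, and a short root may be written with either
  of its two names. These symmetries reduce the commutator formula to few configurations of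
  indices.
\<close>

lemma chevalley_swap:
  assumes "i \<in> Omega n" "j \<in> Omega n" "i \<noteq> j" "k \<in> Omega n" "l \<in> Omega n" "k \<noteq> l"
    and "chevalley Y X k l i j"
  shows "chevalley X Y i j k l"
  unfolding chevalley_def
proof (intro ballI)
  fix a b assume "a \<in> entries bar lam X i j" "b \<in> entries bar lam Y k l"
  then have "inv\<^bsub>G\<^esub> (commutator G (T k l b) (T i j a))
      \<in> generate G (root_gens (sym_prod bar lam Lam Y X) (cone (root_vec k l) (root_vec i j)))"
    using assms(7) unfolding chevalley_def
    by (intro generate_m_inv_closed[OF root_gens_carrier]) blast
  moreover have "inv\<^bsub>G\<^esub> (commutator G (T k l b) (T i j a)) = commutator G (T i j a) (T k l b)"
    using assms by (intro inv_commutator) simp_all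
  ultimately show "commutator G (T i j a) (T k l b)
      \<in> generate G (root_gens (sym_prod bar lam Lam X Y) (cone (root_vec i j) (root_vec k l)))"
    by (simp only: sym_prod_commute[of _ _ _ X Y] cone_commute[of "root_vec i j"])
qed

lemma chevalley_flip_right:
  assumes Y: "form_ideal bar lam Lam Y" and "k \<in> Omega n" "l \<in> Omega n" "k \<noteq> l"
    and *: "chevalley X Y i j (- l) (- k)"
  shows "chevalley X Y i j k l"
proof (cases "l = - k")
  case True
  then show ?thesis using * by simp
next
  case False
  then show ?thesis
    using * entry_flip[OF Y False] T_flip[OF assms(2-4) False] root_vec_flip[of l k]
    unfolding chevalley_def by metis
qed

lemma chevalley_flip_left:
  assumes X: "form_ideal bar lam Lam X" and "i \<in> Omega n" "j \<in> Omega n" "i \<noteq> j"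
    and *: "chevalley X Y (- j) (- i) k l"
  shows "chevalley X Y i j k l"
proof (cases "j = - i")
  case True
  then show ?thesis using * by simp
next
  case False
  then show ?thesis
    using * entry_flip[OF X False] T_flip[OF assms(2-4) False] root_vec_flip[of j i]
    unfolding chevalley_def by metis
qed

lemma chevalley_long_short:
  assumes X: "form_ideal bar lam Lam X" and Y: "form_ideal bar lam Lam Y"
    and ij: "i \<in> Omega n" "j \<in> Omega n" "i \<noteq> j" "i \<noteq> - j"
  shows "chevalley X Y i (- i) (- i) j"
  unfolding chevalley_def
proof (intro ballI)
  fix a b assume a: "a \<in> entries bar lam X i (- i)" and b: "b \<in> entries bar lam Y (- i) j"
  let ?R = "sym_prod bar lam Lam X Y" and ?\<Phi> = "cone (root_vec i (- i)) (root_vec (- i) j)"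
  let ?c = "- (adj (- i) j b * a * b)"
  have nz: "i \<noteq> 0" "j \<noteq> 0" using ij by (auto simp: Omega_nonzero)
  have b': "b \<in> fst Y" using b ij by (simp add: entries_short)
  have ne: "j \<noteq> - i" "- i \<noteq> j" "- j \<noteq> j" "i \<noteq> - i" using ij nz by auto
  note Om = ij(1,2) ij(1,2)[THEN Omega_uminus]
  have r1: "root_vec i j \<in> ?\<Phi>"
    by (rule coneI[where p = 1 and q = 1]) (simp_all add: root_vec_def)
  have r2: "root_vec (- j) j \<in> ?\<Phi>"
    by (rule coneI[where p = 1 and q = 2]) (simp_all add: root_vec_def)
  have "T i j (a * b) \<in> generate G (root_gens ?R ?\<Phi>)"
    using mult_in_sym_prod[OF X Y long_entry_in_ideal[OF X nz(1) a] b'] Om ij r1 ne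
    by (intro root_gensI) (simp_all add: entries_short del: sym_prod.simps)
  moreover have "T (- j) j ?c \<in> generate G (root_gens ?R ?\<Phi>)"
    using conj_in_sym_prod[OF X Y nz a b'] Om ne r2 by (intro root_gensI) auto
  ultimately have "T i j (a * b) \<otimes>\<^bsub>G\<^esub> T (- j) j ?c \<in> generate G (root_gens ?R ?\<Phi>)"
    by (rule generate.eng)
  moreover have "commutator G (T i (- i) a) (T (- i) j b) = T i j (a * b) \<otimes>\<^bsub>G\<^esub> T (- j) j ?c"
    using T_long_short[OF ij long_entry_skew[OF X nz(1) a], of b] Om ne ij
      T_carrier[of i j "a * b"] T_carrier[of "- j" j ?c]
      m_closed[of "T i j (a * b)" "T (- j) j ?c"]
    by (intro commutator_eqI) simp_all
  ultimately show "commutator G (T i (- i) a) (T (- i) j b) \<in> generate G (root_gens ?R ?\<Phi>)"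
    by simp
qed

lemma chevalley_adjacent:
  assumes X: "form_ideal bar lam Lam X" and Y: "form_ideal bar lam Lam Y"
    and ijl: "i \<in> Omega n" "j \<in> Omega n" "l \<in> Omega n" "i \<noteq> j" "j \<noteq> l" "l \<noteq> i"
  shows "chevalley X Y i j j l"
proof -
  have nz: "i \<noteq> 0" "j \<noteq> 0" "l \<noteq> 0" using ijl by (auto simp: Omega_nonzero)
  note Om = ijl(1-3) ijl(1-3)[THEN Omega_uminus]
  have sum: "root_vec i l \<in> cone (root_vec i j) (root_vec j l)"
    by (rule coneI[where p = 1 and q = 1]) (simp_all add: root_vec_def)
  consider "j = - i" | "j \<noteq> - i" "l = - j" | "j \<noteq> - i" "l \<noteq> - j" "l = - i"
    | "j \<noteq> - i" "l \<noteq> - j" "l \<noteq> - i" by blast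
  then show ?thesis
  proof cases
    case 1
    then show ?thesis using chevalley_long_short[OF X Y, of i l] ijl by auto
  next
    (* a short root followed by a long one: the mirror image of the previous case *)
    case 2
    have "chevalley Y X j (- j) (- j) (- i)"
      using 2 ijl Om by (intro chevalley_long_short[OF Y X]) auto
    then have "chevalley Y X j (- j) i j"
      by (intro chevalley_flip_right[OF X ijl(1,2,4)])
    moreover have "j \<noteq> - j" using nz by simp
    ultimately show ?thesis
      unfolding 2(2) using chevalley_swap[OF ijl(1,2,4) ijl(2) Om(5)] by blast
  next
    case 3
    show ?thesis
      unfolding chevalley_def
    proof (intro ballI)
      fix a b assume "a \<in> entries bar lam X i j" "b \<in> entries bar lam Y j l"
      then have ab: "a \<in> fst X" "b \<in> fst Y" using 3 by (auto simp: entries_short)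
      have "commutator G (T i j a) (T j l b) = T i (- i) (a * b - adj i (- i) (a * b))"
        using T_short_short_long[of i j a b] 3 ijl Om nz
        by (intro commutator_eqI) auto
      then show "commutator G (T i j a) (T j l b)
          \<in> generate G (root_gens (sym_prod bar lam Lam X Y) (cone (root_vec i j) (root_vec j l)))"
        using skew_in_sym_prod[OF X Y nz(1) ab] sum Om 3 ijl
        by (auto intro!: root_gensI simp del: sym_prod.simps)
    qed
  next
    case 4
    show ?thesis
      unfolding chevalley_def
    proof (intro ballI)
      fix a b assume "a \<in> entries bar lam X i j" "b \<in> entries bar lam Y j l"
      then have ab: "a \<in> fst X" "b \<in> fst Y" using 4 by (auto simp: entries_short)
      have "commutator G (T i j a) (T j l b) = T i l (a * b)"
        using T_short_short[of i j l a b] 4 ijl Om nz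
        by (intro commutator_eqI) auto
      then show "commutator G (T i j a) (T j l b)
          \<in> generate G (root_gens (sym_prod bar lam Lam X Y) (cone (root_vec i j) (root_vec j l)))"
        using mult_in_sym_prod[OF X Y ab] sum Om 4 ijl
        by (auto intro!: root_gensI simp: entries_short simp del: sym_prod.simps)
    qed
  qed
qed

text \<open>
  The matrix units of two root elements have nonzero products only if one of the indices of
  the first root matches one of the second; up to the name of the roots the matching indices
  are adjacent, and otherwise the root elements commute.
\<close>

lemma chevalley_non_opposite:
  assumes X: "form_ideal bar lam Lam X" and Y: "form_ideal bar lam Lam Y"
    and ij: "i \<in> Omega n" "j \<in> Omega n" "i \<noteq> j" and kl: "k \<in> Omega n" "l \<in> Omega n" "k \<noteq> l"
    and non_opp: "\<not> (k = j \<and> l = i)" "\<not> (k = - i \<and> l = - j)"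
  shows "chevalley X Y i j k l"
proof -
  note Om = ij(1,2) ij(1,2)[THEN Omega_uminus] kl(1,2) kl(1,2)[THEN Omega_uminus]
  consider "j = k" | "j = - l" | "i = - k" | "i = l"
    | "j \<noteq> k" "j \<noteq> - l" "i \<noteq> - k" "i \<noteq> l" by blast
  then show ?thesis
  proof cases
    case 1
    then show ?thesis using chevalley_adjacent[OF X Y, of i j l] ij kl non_opp by auto
  next
    case 2
    have "chevalley X Y i j (- l) (- k)"
      using chevalley_adjacent[OF X Y, of i j "- k"] 2 Om ij kl non_opp by auto
    then show ?thesis by (rule chevalley_flip_right[OF Y kl])
  next
    case 3
    have "chevalley X Y (- j) (- i) k l"
      using chevalley_adjacent[OF X Y, of "- j" "- i" l] 3 Om ij kl non_opp by auto
    then show ?thesis by (rule chevalley_flip_left[OF X ij])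
  next
    case 4
    have "chevalley X Y (- j) (- i) (- l) (- k)"
      using chevalley_adjacent[OF X Y, of "- j" "- i" "- k"] 4 Om ij kl non_opp by auto
    then have "chevalley X Y (- j) (- i) k l" by (rule chevalley_flip_right[OF Y kl])
    then show ?thesis by (rule chevalley_flip_left[OF X ij])
  next
    case 5
    have "commutator G (T i j a) (T k l b) = \<one>\<^bsub>G\<^esub>" for a b
      unfolding commutator_eq_one_iff[OF T_carrier[OF ij] T_carrier[OF kl]]
      using T_commute[OF ij(1,2) kl(1,2) 5] by simp
    then show ?thesis
      unfolding chevalley_def by (metis generate.one)
  qed
qed

end

section \<open>Central commutators modulo a normal subgroup\<close>

definition centre :: "('g, 'b) monoid_scheme \<Rightarrow> 'g set" where
  "centre G = {z \<in> carrier G. \<forall>g \<in> carrier G. z \<otimes>\<^bsub>G\<^esub> g = g \<otimes>\<^bsub>G\<^esub> z}"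

context group
begin

lemma commutes_with_generate:
  assumes S: "S \<subseteq> carrier G" and z: "z \<in> carrier G" and comm: "\<And>s. s \<in> S \<Longrightarrow> z \<otimes> s = s \<otimes> z"
    and x: "x \<in> generate G S"
  shows "z \<otimes> x = x \<otimes> z"
  using x
proof induction
  case (inv s)
  then have s: "s \<in> carrier G" using S by auto
  have "inv s \<otimes> z = inv s \<otimes> (z \<otimes> s) \<otimes> inv s" using s z by (simp add: m_assoc)
  also have "\<dots> = z \<otimes> inv s"
    unfolding comm[OF inv] using s z by (simp add: m_assoc[symmetric])
  finally show ?case by simp
next
  case (eng x y)
  have xy: "x \<in> carrier G" "y \<in> carrier G" using eng.hyps generate_in_carrier[OF S] by auto
  have "z \<otimes> (x \<otimes> y) = x \<otimes> z \<otimes> y"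
    using eng.IH(1) xy z by (simp add: m_assoc[symmetric])
  then show ?case using eng.IH(2) xy z by (simp add: m_assoc)
qed (use z comm in simp_all)

lemma generate_commutes_with_generate:
  assumes "S \<subseteq> carrier G" "R \<subseteq> carrier G" "\<And>s r. s \<in> S \<Longrightarrow> r \<in> R \<Longrightarrow> s \<otimes> r = r \<otimes> s"
    and "x \<in> generate G S" "y \<in> generate G R"
  shows "x \<otimes> y = y \<otimes> x"
proof -
  have y: "y \<in> carrier G" by (rule generate_in_carrier[OF assms(2,5)])
  have "s \<otimes> y = y \<otimes> s" if "s \<in> S" for s
    using that assms(1) by (intro commutes_with_generate[OF assms(2) _ assms(3) assms(5)]) auto
  then have "y \<otimes> x = x \<otimes> y"
    by (intro commutes_with_generate[OF assms(1) y _ assms(4)]) simp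
  then show ?thesis by simp
qed

lemma subgroup_centre: "subgroup (centre G) G"
proof (rule subgroupI)
  show "centre G \<noteq> {}" by (auto simp: centre_def intro!: exI[of _ \<one>])
next
  fix z assume z: "z \<in> centre G"
  then have "inv z \<otimes> g = g \<otimes> inv z" if "g \<in> carrier G" for g
    using commutes_with_generate[of "{z}" g "inv z"] that by (auto simp: centre_def generate.inv)
  then show "inv z \<in> centre G" using z by (auto simp: centre_def)
next
  fix y z assume "y \<in> centre G" "z \<in> centre G"
  then have yz: "y \<in> carrier G" "z \<in> carrier G" "\<And>g. g \<in> carrier G \<Longrightarrow> y \<otimes> g = g \<otimes> y"
    "\<And>g. g \<in> carrier G \<Longrightarrow> z \<otimes> g = g \<otimes> z" by (auto simp: centre_def)
  have "y \<otimes> z \<otimes> g = g \<otimes> (y \<otimes> z)" if g: "g \<in> carrier G" for g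
  proof -
    have "y \<otimes> z \<otimes> g = y \<otimes> g \<otimes> z" using yz(1,2) yz(4)[OF g] g by (simp add: m_assoc)
    then show ?thesis using yz(1,2) yz(3)[OF g] g by (simp add: m_assoc)
  qed
  then show "y \<otimes> z \<in> centre G" using yz(1,2) by (simp add: centre_def)
qed (auto simp: centre_def)

text \<open>
  If \<open>[a, y]\<close> and \<open>[b, y]\<close> are central, then \<open>[ab, y] = [b, y] [a, y]\<close> and
  \<open>[a\<inverse>, y] = [a, y]\<inverse>\<close>.
\<close>

lemma commutator_generate_left:
  assumes S: "S \<subseteq> carrier G" and y: "y \<in> carrier G"
    and central: "\<And>s. s \<in> S \<Longrightarrow> commutator G s y \<in> centre G"
    and x: "x \<in> generate G S"
  shows "commutator G x y \<in> centre G"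
proof -
  interpret C: subgroup "centre G" G by (rule subgroup_centre)
  have swap: "c \<otimes> g = g \<otimes> c" if "c \<in> centre G" "g \<in> carrier G" for c g
    using that unfolding centre_def by blast
  show ?thesis
    using x
  proof induction
    case one
    have "commutator G \<one> y = \<one>" using y by (simp add: commutator_def)
    then show ?case by simp
  next
    case (inv s)
    then have s: "s \<in> carrier G" using S by auto
    let ?c = "commutator G s y"
    have c: "?c \<in> centre G" "?c \<in> carrier G" using central[OF inv] s y by auto
    have "?c \<otimes> (inv s \<otimes> y) = inv s \<otimes> (?c \<otimes> (y \<otimes> s)) \<otimes> inv s"
    proof -
      have "inv s \<otimes> (?c \<otimes> (y \<otimes> s)) \<otimes> inv s = inv s \<otimes> ?c \<otimes> y \<otimes> (s \<otimes> inv s)"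
        using s y c(2) by (simp add: m_assoc del: r_inv)
      also have "\<dots> = ?c \<otimes> (inv s \<otimes> y)"
        unfolding swap[OF c(1) inv_closed[OF s], symmetric] using s y c(2) by (simp add: m_assoc)
      finally show ?thesis by simp
    qed
    also have "\<dots> = y \<otimes> inv s"
      unfolding commutator_rel[OF s y] using s y by (simp add: m_assoc[symmetric])
    finally have "inv s \<otimes> y = inv ?c \<otimes> (y \<otimes> inv s)"
      using s y c(2) by (simp add: inv_solve_left)
    then have "commutator G (inv s) y = inv ?c"
      using s y c(2) by (intro commutator_eqI) auto
    then show ?case using c(1) by simp
  next
    case (eng a b)
    have ab: "a \<in> carrier G" "b \<in> carrier G" using eng.hyps generate_in_carrier[OF S] by auto
    let ?c = "commutator G a y" and ?d = "commutator G b y"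
    have cd: "?c \<in> carrier G" "?d \<in> carrier G" using ab y by auto
    have "a \<otimes> b \<otimes> y = a \<otimes> (?d \<otimes> (y \<otimes> b))"
      using commutator_rel[OF ab(2) y] ab y by (simp add: m_assoc)
    also have "\<dots> = ?d \<otimes> (a \<otimes> y) \<otimes> b"
      using swap[OF eng.IH(2) ab(1)] ab y cd by (simp add: m_assoc[symmetric])
    also have "\<dots> = ?d \<otimes> (?c \<otimes> (y \<otimes> a)) \<otimes> b"
      unfolding commutator_rel[OF ab(1) y] ..
    also have "\<dots> = ?d \<otimes> ?c \<otimes> (y \<otimes> (a \<otimes> b))"
      using ab y cd by (simp add: m_assoc)
    finally have "commutator G (a \<otimes> b) y = ?d \<otimes> ?c"
      using ab y cd by (intro commutator_eqI) auto
    then show ?case using eng.IH by simp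
  qed (rule central)
qed

lemma commutator_generate_central:
  assumes S: "S \<subseteq> carrier G" and R: "R \<subseteq> carrier G"
    and central: "\<And>s r. s \<in> S \<Longrightarrow> r \<in> R \<Longrightarrow> commutator G s r \<in> centre G"
    and x: "x \<in> generate G S" and y: "y \<in> generate G R"
  shows "commutator G x y \<in> centre G"
proof -
  interpret C: subgroup "centre G" G by (rule subgroup_centre)
  have inv_mem: "commutator G b a \<in> centre G"
    if "commutator G a b \<in> centre G" "a \<in> carrier G" "b \<in> carrier G" for a b
    unfolding inv_commutator[OF that(2,3), symmetric] by (rule C.m_inv_closed[OF that(1)])
  have xy: "x \<in> carrier G" "y \<in> carrier G"
    using generate_in_carrier[OF S x] generate_in_carrier[OF R y] .
  have "commutator G s y \<in> centre G" if s: "s \<in> S" for s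
  proof -
    have sc: "s \<in> carrier G" using s S by auto
    have "commutator G r s \<in> centre G" if r: "r \<in> R" for r
      by (rule inv_mem[OF central[OF s r] sc]) (use R r in auto)
    then have "commutator G y s \<in> centre G"
      by (rule commutator_generate_left[OF R sc _ y])
    then show ?thesis by (rule inv_mem[OF _ xy(2) sc])
  qed
  then show ?thesis
    by (rule commutator_generate_left[OF S xy(2) _ x])
qed

text \<open>
  The definitions of \<open>u\<close> and \<open>v\<close> say \<open>gY = Ygu\<close> and \<open>gX = Xgv\<close>. Moving \<open>g\<close> through \<open>XY\<close> and through
  \<open>YX\<close> therefore leaves the same element \<open>guv\<close> on the right, so \<open>XY(YX)\<inverse>\<close> commutes with \<open>g\<close>.
\<close>

lemma commutator_commutes_if_conjugates_commute:
  assumes X: "X \<in> carrier G" and Y: "Y \<in> carrier G" and g: "g \<in> carrier G"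
    and u_def: "u = commutator G (inv g) (inv Y)" and v_def: "v = commutator G (inv g) (inv X)"
    and uX: "X \<otimes> u = u \<otimes> X" and vY: "v \<otimes> Y = Y \<otimes> v" and uv: "v \<otimes> u = u \<otimes> v"
  shows "commutator G X Y \<otimes> g = g \<otimes> commutator G X Y"
proof -
  have u: "u \<in> carrier G" and v: "v \<in> carrier G" using X Y g by (simp_all add: u_def v_def)
  have cancel: "a \<otimes> (inv a \<otimes> b) = b" if "a \<in> carrier G" "b \<in> carrier G" for a b
    using that by (simp add: m_assoc[symmetric])
  have gY: "g \<otimes> Y = Y \<otimes> g \<otimes> u" and gX: "g \<otimes> X = X \<otimes> g \<otimes> v"
    using X Y g unfolding u_def v_def commutator_def by (simp_all add: m_assoc cancel)
  let ?w = "g \<otimes> u \<otimes> v"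
  note cl = X Y g u v
  have "g \<otimes> (X \<otimes> Y) = X \<otimes> g \<otimes> (v \<otimes> Y)"
    using gX cl by (simp add: m_assoc[symmetric])
  also have "\<dots> = X \<otimes> (g \<otimes> Y) \<otimes> v" unfolding vY using cl by (simp add: m_assoc)
  also have "\<dots> = X \<otimes> Y \<otimes> ?w" unfolding gY using cl by (simp add: m_assoc)
  finally have XY: "g \<otimes> (X \<otimes> Y) = X \<otimes> Y \<otimes> ?w" .
  have "g \<otimes> (Y \<otimes> X) = Y \<otimes> g \<otimes> (u \<otimes> X)"
    using gY cl by (simp add: m_assoc[symmetric])
  also have "\<dots> = Y \<otimes> (g \<otimes> X) \<otimes> u" unfolding uX[symmetric] using cl by (simp add: m_assoc)
  also have "\<dots> = Y \<otimes> X \<otimes> (g \<otimes> (v \<otimes> u))" unfolding gX using cl by (simp add: m_assoc)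
  also have "\<dots> = Y \<otimes> X \<otimes> ?w" unfolding uv using cl by (simp add: m_assoc)
  finally have YX: "g \<otimes> (Y \<otimes> X) = Y \<otimes> X \<otimes> ?w" .
  let ?i = "inv (Y \<otimes> X)"
  have i: "?i \<in> carrier G" "Y \<otimes> X \<in> carrier G" "X \<otimes> Y \<in> carrier G" "?w \<in> carrier G"
    using cl by auto
  have "?i \<otimes> g = ?i \<otimes> (g \<otimes> (Y \<otimes> X)) \<otimes> ?i" using i g by (simp add: m_assoc del: inv_mult_group)
  also have "\<dots> = ?w \<otimes> ?i"
    unfolding YX using i g by (simp add: m_assoc[symmetric] del: inv_mult_group)
  finally have wi: "?i \<otimes> g = ?w \<otimes> ?i" .
  have "commutator G X Y \<otimes> g = X \<otimes> Y \<otimes> (?i \<otimes> g)"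
    unfolding commutator_alt[OF X Y] using i g by (simp add: m_assoc del: inv_mult_group)
  also have "\<dots> = X \<otimes> Y \<otimes> ?w \<otimes> ?i"
    unfolding wi using i by (simp add: m_assoc del: inv_mult_group)
  also have "\<dots> = g \<otimes> commutator G X Y"
    unfolding XY[symmetric] commutator_alt[OF X Y] using i g
    by (simp add: m_assoc del: inv_mult_group)
  finally show ?thesis .
qed

end

text \<open>
  Congruence modulo \<open>N\<close> is treated as equality in the quotient of \<open>E\<close> by \<open>N\<close>. Both \<open>E\<close> and \<open>N\<close>
  are subsets of an ambient group, in which generation and commutators are taken.
\<close>

locale subquotient = group G for G (structure) +
  fixes E N
  assumes subgroup_E: "subgroup E G" and normal_N: "N \<lhd> G\<lparr>carrier := E\<rparr>"
begin

definition Q where "Q = G\<lparr>carrier := E\<rparr> Mod N"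

definition residue where "residue x = N #>\<^bsub>G\<lparr>carrier := E\<rparr>\<^esub> x"

sublocale sub: group "G\<lparr>carrier := E\<rparr>"
  using subgroup.subgroup_is_group[OF subgroup_E] group_axioms by blast

sublocale nor: normal N "G\<lparr>carrier := E\<rparr>"
  by (rule normal_N)

sublocale Q: group Q
  unfolding Q_def by (rule nor.factorgroup_is_group)

sublocale class_hom: group_hom "G\<lparr>carrier := E\<rparr>" Q residue
proof
  show "residue \<in> hom (G\<lparr>carrier := E\<rparr>) Q"
    using nor.r_coset_hom_Mod unfolding residue_def[abs_def] Q_def .
qed

lemma carrier_Q: "carrier Q = residue ` E"
  by (auto simp: FactGroup_def RCOSETS_def Q_def residue_def)

lemma residue_closed: "x \<in> E \<Longrightarrow> residue x \<in> carrier Q"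
  by (simp add: carrier_Q)

lemma residue_mult: "x \<in> E \<Longrightarrow> y \<in> E \<Longrightarrow> residue (x \<otimes> y) = residue x \<otimes>\<^bsub>Q\<^esub> residue y"
  using class_hom.hom_mult[of x y] by simp

lemma residue_inv: "x \<in> E \<Longrightarrow> residue (inv x) = inv\<^bsub>Q\<^esub> (residue x)"
  using class_hom.hom_inv[of x] m_inv_consistent[OF subgroup_E] by simp

lemma residue_commutator:
  assumes "x \<in> E" "y \<in> E"
  shows "residue (commutator G x y) = commutator Q (residue x) (residue y)"
  using assms subgroup_E
  by (simp add: commutator_def residue_mult residue_inv subgroup.m_inv_closed subgroup.m_closed)

lemma residue_eq_one_iff:
  assumes "x \<in> E"
  shows "residue x = \<one>\<^bsub>Q\<^esub> \<longleftrightarrow> x \<in> N"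
proof -
  have one: "\<one>\<^bsub>Q\<^esub> = N" by (simp add: Q_def FactGroup_def)
  show ?thesis
    unfolding one residue_def
    using assms sub.coset_join1[OF _ _ nor.subgroup_axioms] nor.rcos_const[OF sub.is_group]
    by auto
qed

lemma residue_generate:
  assumes "S \<subseteq> E" "x \<in> generate G S"
  shows "residue x \<in> generate Q (residue ` S)"
  using class_hom.generate_img[of S] generate_consistent[OF assms(1) subgroup_E] assms by auto

lemma N_subset: "N \<subseteq> E"
  using nor.subset by simp

lemma subgroup_N: "subgroup N G"
  using incl_subgroup[OF subgroup_E nor.subgroup_axioms] .

lemma commutator_E: "x \<in> E \<Longrightarrow> y \<in> E \<Longrightarrow> commutator G x y \<in> E"
  using subgroup_E by (simp add: commutator_def subgroup.m_inv_closed subgroup.m_closed)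

text \<open>
  The centre of the quotient is a subgroup, and elements that are central modulo \<open>N\<close> have their
  commutators with \<open>E\<close> in \<open>N\<close>; so the claim follows from the extension of central commutators
  from generators to the subgroups they generate.
\<close>

lemma comm_subgroup_central_mod:
  assumes S: "S \<subseteq> E" and R: "R \<subseteq> E"
    and central: "\<And>s r. s \<in> S \<Longrightarrow> r \<in> R \<Longrightarrow> residue (commutator G s r) \<in> centre Q"
  shows "comm_subgroup G (comm_subgroup G (generate G S) (generate G R)) E \<subseteq> N"
proof -
  have gen_E: "generate G S \<subseteq> E" "generate G R \<subseteq> E"
    using generate_subgroup_incl[OF _ subgroup_E] S R by auto
  have "residue (commutator G x y) \<in> centre Q" if "x \<in> generate G S" "y \<in> generate G R" for x y
  proof -
    have "commutator Q (residue x) (residue y) \<in> centre Q"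
    proof (rule Q.commutator_generate_central)
      show "residue x \<in> generate Q (residue ` S)" "residue y \<in> generate Q (residue ` R)"
        using residue_generate S R that by auto
      show "residue ` S \<subseteq> carrier Q" "residue ` R \<subseteq> carrier Q"
        using S R residue_closed by auto
      fix s r assume "s \<in> residue ` S" "r \<in> residue ` R"
      then obtain s' r' where "s' \<in> S" "r' \<in> R" "s = residue s'" "r = residue r'" by blast
      then show "commutator Q s r \<in> centre Q"
        using central[of s' r'] subsetD[OF S] subsetD[OF R] by (simp add: residue_commutator)
    qed
    then show ?thesis
      using that subsetD[OF gen_E(1)] subsetD[OF gen_E(2)] by (simp add: residue_commutator)
  qed
  then have gens: "residue z \<in> centre Q"
    if "z \<in> {commutator G x y | x y. x \<in> generate G S \<and> y \<in> generate G R}" for z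
    using that by auto
  let ?C = "comm_subgroup G (generate G S) (generate G R)"
  let ?K = "{commutator G x y | x y. x \<in> generate G S \<and> y \<in> generate G R}"
  have K: "?C = generate G ?K" "?K \<subseteq> E"
    using gen_E commutator_E by (auto simp: comm_subgroup_def commutator_def[symmetric])
  have C: "z \<in> E \<and> residue z \<in> centre Q" if "z \<in> ?C" for z
  proof
    have z: "z \<in> generate G ?K" using that K(1) by simp
    then show "z \<in> E" using generate_subgroup_incl[OF K(2) subgroup_E] by blast
    have "generate Q (residue ` ?K) \<subseteq> centre Q"
      using gens by (intro Q.generate_subgroup_incl[OF _ Q.subgroup_centre]) blast
    then show "residue z \<in> centre Q" using residue_generate[OF K(2) z] by blast
  qed
  have "commutator G z e \<in> N" if "z \<in> ?C" "e \<in> E" for z e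
  proof -
    have "residue z \<otimes>\<^bsub>Q\<^esub> residue e = residue e \<otimes>\<^bsub>Q\<^esub> residue z"
      using C[OF that(1)] residue_closed[OF that(2)] by (simp add: centre_def)
    then have "residue (commutator G z e) = \<one>\<^bsub>Q\<^esub>"
      using C[OF that(1)] that(2)
      by (simp only: residue_commutator Q.commutator_eq_one_iff residue_closed)
    then show ?thesis
      using residue_eq_one_iff commutator_E C that by blast
  qed
  then show ?thesis
    unfolding comm_subgroup_def[of _ ?C] commutator_def[symmetric]
    by (intro generate_subgroup_incl[OF _ subgroup_N]) blast
qed

end

text \<open>
  Here \<open>N\<close> stands for any of the normal subgroups whose intersection is the elementary subgroup
  of level \<open>X \<circ> Y\<close>.
\<close>

locale two_form_ideals = form_ring_rank bar lam Lam n
  for bar :: "'a::{ring,monoid_mult} \<Rightarrow> 'a" and lam :: 'a and Lam :: "'a set" and n :: nat +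
  fixes X Y :: "'a set \<times> 'a set" and N :: "'a mat set"
  assumes X: "form_ideal bar lam Lam X" and Y: "form_ideal bar lam Lam Y"
    and rank: "n \<ge> 3"
    and N: "N \<lhd> G\<lparr>carrier := EU_abs n bar lam Lam\<rparr>"
    and FU_N: "FU n bar lam (sym_prod bar lam Lam X Y) \<subseteq> N"
begin

abbreviation E where "E \<equiv> EU_abs n bar lam Lam"

abbreviation total where "total \<equiv> (UNIV :: 'a set, Lam)"

lemma E_eq: "E = generate G (root_gens total UNIV)"
  by (simp add: EU_abs_def FU_eq)

sublocale subquotient G E N
proof (intro subquotient.intro subquotient_axioms.intro)
  show "group G" by (rule group_axioms)
  show "subgroup E G"
    unfolding E_eq by (rule generate_is_subgroup[OF root_gens_carrier])
qed (rule N)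

lemma entries_total:
  assumes "form_ideal bar lam Lam Z"
  shows "entries bar lam Z i j \<subseteq> entries bar lam total i j"
  using assms by (cases Z) (auto simp: Gamma_max_def)

lemma root_gens_E: "form_ideal bar lam Lam Z \<Longrightarrow> root_gens Z \<Phi> \<subseteq> E"
  unfolding E_eq root_gens_def using entries_total by (intro subsetI generate.incl) blast

lemma T_in_E:
  assumes "i \<in> Omega n" "j \<in> Omega n" "i \<noteq> j" "form_ideal bar lam Lam Z" "a \<in> entries bar lam Z i j"
  shows "T i j a \<in> E"
  using root_gens_E[OF assms(4), of UNIV] assms by (auto simp: root_gens_def)

lemma sym_prod_generate_N: "generate G (root_gens (sym_prod bar lam Lam X Y) \<Phi>) \<subseteq> N"
proof -
  have "root_gens (sym_prod bar lam Lam X Y) \<Phi> \<subseteq> root_gens (sym_prod bar lam Lam X Y) UNIV"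
    unfolding root_gens_def by blast
  then show ?thesis using mono_generate FU_N unfolding FU_eq by blast
qed

text \<open>
  The consequence of the commutator formula that drives the argument: commutators of root
  elements at non-opposite roots lie in \<open>N\<close>.
\<close>

lemma non_opposite_commute:
  assumes x: "x \<in> generate G (root_gens X \<Phi>)" and y: "y \<in> generate G (root_gens Y \<Psi>)"
    and non_opp: "\<And>\<phi> \<psi>. \<phi> \<in> \<Phi> \<Longrightarrow> \<psi> \<in> \<Psi> \<Longrightarrow> \<exists>m. \<phi> m \<noteq> - \<psi> m"
  shows "residue x \<otimes>\<^bsub>Q\<^esub> residue y = residue y \<otimes>\<^bsub>Q\<^esub> residue x"
proof (rule Q.generate_commutes_with_generate)
  show "residue x \<in> generate Q (residue ` root_gens X \<Phi>)"
    by (rule residue_generate[OF root_gens_E[OF X] x])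
  show "residue y \<in> generate Q (residue ` root_gens Y \<Psi>)"
    by (rule residue_generate[OF root_gens_E[OF Y] y])
  show "residue ` root_gens X \<Phi> \<subseteq> carrier Q" "residue ` root_gens Y \<Psi> \<subseteq> carrier Q"
    using root_gens_E[OF X, of \<Phi>] root_gens_E[OF Y, of \<Psi>] residue_closed by blast+
  fix s r assume "s \<in> residue ` root_gens X \<Phi>" "r \<in> residue ` root_gens Y \<Psi>"
  then obtain i j a k l b where s: "s = residue (T i j a)" and r: "r = residue (T k l b)"
    and ij: "i \<in> Omega n" "j \<in> Omega n" "i \<noteq> j" "root_vec i j \<in> \<Phi>" "a \<in> entries bar lam X i j"
    and kl: "k \<in> Omega n" "l \<in> Omega n" "k \<noteq> l" "root_vec k l \<in> \<Psi>" "b \<in> entries bar lam Y k l"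
    unfolding root_gens_def by blast
  obtain m where "root_vec i j m \<noteq> - root_vec k l m" using non_opp[OF ij(4) kl(4)] by blast
  then have "\<not> (k = j \<and> l = i)" "\<not> (k = - i \<and> l = - j)"
    by (auto simp: root_vec_def)
  then have "commutator G (T i j a) (T k l b) \<in> N"
    using chevalley_non_opposite[OF X Y ij(1-3) kl(1-3)] ij(5) kl(5) sym_prod_generate_N
    unfolding chevalley_def by blast
  moreover have E: "T i j a \<in> E" "T k l b \<in> E"
    using T_in_E ij kl X Y by blast+
  ultimately have "commutator Q s r = \<one>\<^bsub>Q\<^esub>"
    unfolding s r residue_commutator[OF E, symmetric]
    using residue_eq_one_iff[OF commutator_E[OF E]] by blast
  then show "s \<otimes>\<^bsub>Q\<^esub> r = r \<otimes>\<^bsub>Q\<^esub> s"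
    unfolding s r using Q.commutator_eq_one_iff residue_closed E by blast
qed

lemma root_gens_sym_prod_total:
  assumes "form_ideal bar lam Lam Z"
  shows "root_gens (sym_prod bar lam Lam total Z) \<Phi> \<subseteq> root_gens Z \<Phi>"
proof -
  have "entries bar lam (sym_prod bar lam Lam total Z) i j \<subseteq> entries bar lam Z i j" for i j
    using sym_prod_UNIV_subset[OF assms]
    by (cases Z; cases "sym_prod bar lam Lam total Z") auto
  then show ?thesis unfolding root_gens_def by blast
qed

text \<open>
  Conjugating a root element of a form ideal by an arbitrary one at a non-opposite root produces
  only root elements of that form ideal. The inverses match the shape of the hypotheses of
  \<open>commutator_commutes_if_conjugates_commute\<close>.
\<close>

lemma commutator_with_total:
  assumes Z: "form_ideal bar lam Lam Z"
    and kl: "k \<in> Omega n" "l \<in> Omega n" "k \<noteq> l" and ij: "i \<in> Omega n" "j \<in> Omega n" "i \<noteq> j"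
    and "\<not> (k = j \<and> l = i)" "\<not> (k = - i \<and> l = - j)"
    and c: "c \<in> entries bar lam total k l" and a: "a \<in> entries bar lam Z i j"
  shows "commutator G (inv\<^bsub>G\<^esub> (T k l c)) (inv\<^bsub>G\<^esub> (T i j a))
    \<in> generate G (root_gens Z (cone (root_vec k l) (root_vec i j)))"
proof -
  have "chevalley total Z k l i j"
    using assms by (intro chevalley_non_opposite[OF form_ideal_UNIV Z]) auto
  moreover have "- c \<in> entries bar lam total k l" "- a \<in> entries bar lam Z i j"
    using entry_uminus[OF form_ideal_UNIV _ c] entry_uminus[OF Z _ a] kl ij Omega_nonzero by auto
  ultimately have "commutator G (T k l (- c)) (T i j (- a))
      \<in> generate G (root_gens (sym_prod bar lam Lam total Z) (cone (root_vec k l) (root_vec i j)))"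
    unfolding chevalley_def by blast
  then show ?thesis
    unfolding inv_T[OF kl] inv_T[OF ij]
    using mono_generate[OF root_gens_sym_prod_total[OF Z]] by blast
qed

text \<open>
  The root \<open>(k, l)\<close> differs from \<open>\<plusminus>\<close> the root \<open>(i, j)\<close>, with both names of a short root taken into
  account.
\<close>

definition off_axis :: "int \<Rightarrow> int \<Rightarrow> int \<Rightarrow> int \<Rightarrow> bool" where
  "off_axis i j k l \<longleftrightarrow> \<not> (k = i \<and> l = j) \<and> \<not> (k = - j \<and> l = - i)
     \<and> \<not> (k = j \<and> l = i) \<and> \<not> (k = - i \<and> l = - j)"

lemma off_axis_not_proportional:
  assumes "i \<in> Omega n" "j \<in> Omega n" "i \<noteq> j" "k \<in> Omega n" "l \<in> Omega n" "k \<noteq> l"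
    and "off_axis i j k l" "p \<ge> 1"
  shows "\<exists>m. p * root_vec k l m \<noteq> q * root_vec i j m"
proof (rule ccontr)
  assume "\<not> ?thesis"
  then have "\<And>m. p * root_vec k l m = q * root_vec i j m" by blast
  then show False
    using proportional_roots[of i j k l p q] assms Omega_nonzero[of _ n]
    unfolding off_axis_def by blast
qed

text \<open>
  With \<open>\<alpha> = (i, j)\<close> and \<open>\<beta> = (k, l)\<close>, opposite roots in one of the pairs \<open>x, u\<close> and \<open>v, y\<close> and
  \<open>v, u\<close> would give a relation \<open>p \<beta> = q \<alpha>\<close> with \<open>p \<ge> 1\<close>. Each of the three verifications exhibits this
  relation and contradicts it.
\<close>

lemma opposite_commutator_commutes:
  assumes ij: "i \<in> Omega n" "j \<in> Omega n" "i \<noteq> j"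
    and a: "a \<in> entries bar lam X i j" and b: "b \<in> entries bar lam Y j i"
    and kl: "k \<in> Omega n" "l \<in> Omega n" "k \<noteq> l" and off: "off_axis i j k l"
    and c: "c \<in> entries bar lam total k l"
  shows "residue (commutator G (T i j a) (T j i b)) \<otimes>\<^bsub>Q\<^esub> residue (T k l c)
    = residue (T k l c) \<otimes>\<^bsub>Q\<^esub> residue (commutator G (T i j a) (T j i b))"
proof -
  let ?x = "T i j a" and ?y = "T j i b" and ?g = "T k l c"
  let ?u = "commutator G (inv\<^bsub>G\<^esub> ?g) (inv\<^bsub>G\<^esub> ?y)"
  let ?v = "commutator G (inv\<^bsub>G\<^esub> ?g) (inv\<^bsub>G\<^esub> ?x)"
  have E: "?x \<in> E" "?y \<in> E" "?g \<in> E"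
    using T_in_E[OF ij X a] T_in_E[OF ij(2,1) _ Y b] T_in_E[OF kl form_ideal_UNIV c] ij by auto
  have invE: "inv\<^bsub>G\<^esub> ?x \<in> E" "inv\<^bsub>G\<^esub> ?y \<in> E" "inv\<^bsub>G\<^esub> ?g \<in> E"
    using E subgroup.m_inv_closed[OF subgroup_E] by auto
  have np: "\<exists>m. p * root_vec k l m \<noteq> q * root_vec i j m" if "p \<ge> 1" for p q
    using off_axis_not_proportional[OF ij kl off that] .
  have u: "?u \<in> generate G (root_gens Y (cone (root_vec k l) (root_vec j i)))"
    using off ij by (intro commutator_with_total[OF Y kl ij(2,1) _ _ _ c b]) (auto simp: off_axis_def)
  have v: "?v \<in> generate G (root_gens X (cone (root_vec k l) (root_vec i j)))"
    using off by (intro commutator_with_total[OF X kl ij _ _ c a]) (auto simp: off_axis_def)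
  have x: "?x \<in> generate G (root_gens X {root_vec i j})"
    using ij a by (intro root_gensI) auto
  have y: "?y \<in> generate G (root_gens Y {root_vec j i})"
    using ij b by (intro root_gensI) auto
  have xu: "residue ?x \<otimes>\<^bsub>Q\<^esub> residue ?u = residue ?u \<otimes>\<^bsub>Q\<^esub> residue ?x"
  proof (rule non_opposite_commute[OF x u])
    fix \<phi> \<psi> assume "\<phi> \<in> {root_vec i j}" and \<psi>: "\<psi> \<in> cone (root_vec k l) (root_vec j i)"
    then have \<phi>: "\<phi> = root_vec i j" by simp
    obtain p q where "p \<ge> 1" and pq: "\<And>m. \<psi> m = p * root_vec k l m + q * root_vec j i m"
      using coneE[OF \<psi>] by blast
    then obtain m where "p * root_vec k l m \<noteq> (q - 1) * root_vec i j m" using np by blast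
    then have "\<phi> m \<noteq> - \<psi> m"
      unfolding \<phi> pq root_vec_uminus[of j i] by (simp add: algebra_simps)
    then show "\<exists>m. \<phi> m \<noteq> - \<psi> m" by blast
  qed
  have vy: "residue ?v \<otimes>\<^bsub>Q\<^esub> residue ?y = residue ?y \<otimes>\<^bsub>Q\<^esub> residue ?v"
  proof (rule non_opposite_commute[OF v y])
    fix \<phi> \<psi> assume \<phi>: "\<phi> \<in> cone (root_vec k l) (root_vec i j)" and "\<psi> \<in> {root_vec j i}"
    then have \<psi>: "\<psi> = root_vec j i" by simp
    obtain p q where "p \<ge> 1" and pq: "\<And>m. \<phi> m = p * root_vec k l m + q * root_vec i j m"
      using coneE[OF \<phi>] by blast
    then obtain m where "p * root_vec k l m \<noteq> (1 - q) * root_vec i j m" using np by blast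
    then have "\<phi> m \<noteq> - \<psi> m"
      unfolding \<psi> pq root_vec_uminus[of j i] by (simp add: algebra_simps)
    then show "\<exists>m. \<phi> m \<noteq> - \<psi> m" by blast
  qed
  have vu: "residue ?v \<otimes>\<^bsub>Q\<^esub> residue ?u = residue ?u \<otimes>\<^bsub>Q\<^esub> residue ?v"
  proof (rule non_opposite_commute[OF v u])
    fix \<phi> \<psi> assume \<phi>: "\<phi> \<in> cone (root_vec k l) (root_vec i j)"
      and \<psi>: "\<psi> \<in> cone (root_vec k l) (root_vec j i)"
    obtain p q where p: "p \<ge> 1" and pq: "\<And>m. \<phi> m = p * root_vec k l m + q * root_vec i j m"
      using coneE[OF \<phi>] by blast
    obtain p' q' where p': "p' \<ge> 1" and pq': "\<And>m. \<psi> m = p' * root_vec k l m + q' * root_vec j i m"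
      using coneE[OF \<psi>] by blast
    obtain m where "(p + p') * root_vec k l m \<noteq> (q' - q) * root_vec i j m"
      using np[of "p + p'"] p p' by auto
    then have "\<phi> m \<noteq> - \<psi> m"
      unfolding pq pq' root_vec_uminus[of j i] by (simp add: algebra_simps)
    then show "\<exists>m. \<phi> m \<noteq> - \<psi> m" by blast
  qed
  have "commutator Q (residue ?x) (residue ?y) \<otimes>\<^bsub>Q\<^esub> residue ?g = residue ?g \<otimes>\<^bsub>Q\<^esub> commutator Q (residue ?x) (residue ?y)"
    by (rule Q.commutator_commutes_if_conjugates_commute[OF E[THEN residue_closed] _ _ xu vy vu])
       (simp_all only: residue_commutator E invE residue_inv)
  then show ?thesis using E by (simp add: residue_commutator)
qed

lemma T_short_commutator:
  assumes "i \<in> Omega n" "j \<in> Omega n" "k \<in> Omega n"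
    and "i \<noteq> j" "i \<noteq> - j" "j \<noteq> k" "j \<noteq> - k" "i \<noteq> k" "i \<noteq> - k"
  shows "T i k c = commutator G (T i j c) (T j k 1)"
  using assms T_short_short[OF assms, of c 1] by (intro commutator_eqI[symmetric]) auto

lemma third_index:
  obtains h where "h \<in> Omega n" "\<bar>h\<bar> \<noteq> \<bar>i\<bar>" "\<bar>h\<bar> \<noteq> \<bar>j\<bar>"
proof -
  have "\<exists>h \<in> {1, 2, 3 :: int}. \<bar>h\<bar> \<noteq> \<bar>i\<bar> \<and> \<bar>h\<bar> \<noteq> \<bar>j\<bar>"
    by (cases "\<bar>i\<bar> = 1"; cases "\<bar>j\<bar> = 1"; cases "\<bar>i\<bar> = 2"; cases "\<bar>j\<bar> = 2") auto
  then obtain h where "h \<in> {1, 2, 3 :: int}" "\<bar>h\<bar> \<noteq> \<bar>i\<bar>" "\<bar>h\<bar> \<noteq> \<bar>j\<bar>" by blast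
  then show ?thesis using that[of h] rank by (auto simp: Omega_def)
qed

text \<open>
  A long root element is the long factor in the commutator formula for a long and a short root.
\<close>

lemma T_long_decomposition:
  assumes hk: "h \<in> Omega n" "k \<in> Omega n" "h \<noteq> k" "h \<noteq> - k"
    and c: "c \<in> entries bar lam total k (- k)"
  obtains a where "a \<in> entries bar lam total h (- h)"
    "T k (- k) c = inv\<^bsub>G\<^esub> (T h (- k) a) \<otimes>\<^bsub>G\<^esub> commutator G (T h (- h) a) (T (- h) (- k) 1)"
proof -
  have nz: "h \<noteq> 0" "k \<noteq> 0" "- k \<noteq> 0" using hk by (auto simp: Omega_nonzero)
  note Om = hk(1,2) hk(1,2)[THEN Omega_uminus]
  obtain g where g: "g \<in> Lam" "c = bar (weight k) * g"
    using c nz(2) by (auto simp: entries_long simp del: entries.simps)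
  \<comment> \<open>With \<open>b = 1\<close> the long factor has parameter \<open>- adj (-h) (-k) 1 * a\<close>, so \<open>a\<close> must be the
    negative of \<open>c\<close>, transported from index \<open>k\<close> to index \<open>h\<close>.\<close>
  define a where "a = bar (weight h) * (- g)"
  have "- g \<in> Lam" using g(1) Lam_subgroup by (simp add: add_subgroup_def)
  then have a: "a \<in> entries bar lam total h (- h)"
    unfolding entries_long[OF nz(1)] a_def snd_conv by (rule imageI)
  have "- (adj (- h) (- k) 1 * a * 1) = weight (- k) * (bar (weight (- h)) * (bar (weight h) * g))"
    using nz by (simp add: adj_eq a_def mult.assoc)
  also have "\<dots> = weight (- k) * (bar (weight (- h)) * bar (weight h)) * g" by (simp only: mult.assoc)
  also have "\<dots> = c"
    using weight_bar_weight_bar_weight[OF nz(1,3)] by (simp add: g(2))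
  finally have c_eq: "- (adj (- h) (- k) 1 * a * 1) = c" .
  have ne: "h \<noteq> - k" "h \<noteq> - (- k)" "- h \<noteq> - k" "h \<noteq> - h" "k \<noteq> - k" using hk nz by auto
  have "T h (- h) a * T (- h) (- k) 1
      = T h (- k) a * T k (- k) c * (T (- h) (- k) 1 * T h (- h) a)"
    using T_long_short[OF Om(1,4) ne(1,2) long_entry_skew[OF form_ideal_UNIV nz(1) a], of 1]
    unfolding c_eq by simp
  then have "commutator G (T h (- h) a) (T (- h) (- k) 1) = T h (- k) a \<otimes>\<^bsub>G\<^esub> T k (- k) c"
    using Om ne m_closed[OF T_carrier[OF Om(1,4) ne(1), of a] T_carrier[OF Om(2,4) ne(5), of c]]
    by (intro commutator_eqI) auto
  then have "T k (- k) c = inv\<^bsub>G\<^esub> (T h (- k) a) \<otimes>\<^bsub>G\<^esub> commutator G (T h (- h) a) (T (- h) (- k) 1)"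
    using Om ne m_assoc[symmetric] by (simp add: m_assoc[symmetric] del: mult_GL one_GL)
  with a show ?thesis by (rule that)
qed

text \<open>
  A third index \<open>h\<close> expresses each root element at \<open>\<plusminus>(i, j)\<close> by root elements at roots that
  involve \<open>h\<close>. For short roots this is where \<open>n \<ge> 3\<close> is needed.
\<close>

lemma E_generated_off_axis:
  assumes ij: "i \<in> Omega n" "j \<in> Omega n" "i \<noteq> j"
  shows "E = generate G {T k l c | k l c. k \<in> Omega n \<and> l \<in> Omega n \<and> k \<noteq> l
    \<and> off_axis i j k l \<and> c \<in> entries bar lam total k l}" (is "_ = generate G ?S")
proof
  have S: "?S \<subseteq> root_gens total UNIV" unfolding root_gens_def by blast
  then show "generate G ?S \<subseteq> E" unfolding E_eq by (rule mono_generate)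
  have S_carrier: "?S \<subseteq> carrier G" using S root_gens_carrier by blast
  have incl: "T k l c \<in> generate G ?S"
    if "k \<in> Omega n" "l \<in> Omega n" "k \<noteq> l" "off_axis i j k l" "c \<in> entries bar lam total k l" for k l c
    using that by (intro generate.incl) blast
  have "T k l c \<in> generate G ?S"
    if kl: "k \<in> Omega n" "l \<in> Omega n" "k \<noteq> l" and c: "c \<in> entries bar lam total k l" for k l c
  proof (cases "off_axis i j k l")
    case True
    then show ?thesis using incl kl c by blast
  next
    case False
    obtain h where h: "h \<in> Omega n" "\<bar>h\<bar> \<noteq> \<bar>i\<bar>" "\<bar>h\<bar> \<noteq> \<bar>j\<bar>" by (rule third_index)
    then have off: "off_axis i j h m" "off_axis i j m h" "off_axis i j (- h) m" "off_axis i j m (- h)" for m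
      by (auto simp: off_axis_def)
    have ne: "h \<noteq> k" "h \<noteq> - k" "h \<noteq> l" "h \<noteq> - l"
      using False h by (auto simp: off_axis_def)
    have nz: "h \<noteq> 0" using h by (simp add: Omega_nonzero)
    show ?thesis
    proof (cases "l = - k")
      case False
      have eq: "T k l c = commutator G (T k h c) (T h l 1)"
        using kl h ne False by (intro T_short_commutator) auto
      show ?thesis
        unfolding eq using kl h ne off
        by (intro commutator_in_generate[OF S_carrier] incl) (auto simp: entries_short)
    next
      case True
      obtain a where a: "a \<in> entries bar lam total h (- h)" and
        eq: "T k (- k) c = inv\<^bsub>G\<^esub> (T h (- k) a) \<otimes>\<^bsub>G\<^esub> commutator G (T h (- h) a) (T (- h) (- k) 1)"
        using T_long_decomposition[OF h(1) kl(1) ne(1,2)] c unfolding True by blast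
      have "T h (- k) a \<in> generate G ?S" "T h (- h) a \<in> generate G ?S" "T (- h) (- k) 1 \<in> generate G ?S"
        using kl h ne nz off a Omega_uminus[of _ n] True
        by (auto intro!: incl simp: entries_short simp del: entries.simps)
      then show ?thesis
        unfolding True eq
        by (intro generate.eng generate_m_inv_closed[OF S_carrier] commutator_in_generate[OF S_carrier])
    qed
  qed
  then have "root_gens total UNIV \<subseteq> generate G ?S" unfolding root_gens_def by blast
  then show "E \<subseteq> generate G ?S"
    unfolding E_eq by (rule generate_subgroup_incl[OF _ generate_is_subgroup[OF S_carrier]])
qed

lemma opposite_commutator_central:
  assumes ij: "i \<in> Omega n" "j \<in> Omega n" "i \<noteq> j"
    and a: "a \<in> entries bar lam X i j" and b: "b \<in> entries bar lam Y j i"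
  shows "residue (commutator G (T i j a) (T j i b)) \<in> centre Q"
proof -
  let ?z = "commutator G (T i j a) (T j i b)"
  let ?S = "{T k l c | k l c. k \<in> Omega n \<and> l \<in> Omega n \<and> k \<noteq> l
    \<and> off_axis i j k l \<and> c \<in> entries bar lam total k l}"
  have E: "T i j a \<in> E" "T j i b \<in> E"
    using T_in_E[OF ij X a] T_in_E[OF ij(2,1) _ Y b] ij by auto
  have z: "residue ?z \<in> carrier Q" using E commutator_E residue_closed by blast
  have S: "?S \<subseteq> E"
    using root_gens_E[OF form_ideal_UNIV, of UNIV] unfolding root_gens_def by blast
  have "residue ?z \<otimes>\<^bsub>Q\<^esub> residue e = residue e \<otimes>\<^bsub>Q\<^esub> residue ?z" if "e \<in> E" for e
  proof (rule Q.commutes_with_generate)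
    show "residue e \<in> generate Q (residue ` ?S)"
      using that residue_generate[OF S] E_generated_off_axis[OF ij] by blast
    show "residue ` ?S \<subseteq> carrier Q" using S residue_closed by blast
    show "residue ?z \<otimes>\<^bsub>Q\<^esub> s = s \<otimes>\<^bsub>Q\<^esub> residue ?z" if "s \<in> residue ` ?S" for s
      using that opposite_commutator_commutes[OF ij a b] by blast
  qed (rule z)
  then show ?thesis using z by (auto simp: centre_def carrier_Q)
qed

lemma generator_commutator_central:
  assumes x: "x \<in> root_gens X UNIV" and y: "y \<in> root_gens Y UNIV"
  shows "residue (commutator G x y) \<in> centre Q"
proof -
  obtain i j a where ij: "i \<in> Omega n" "j \<in> Omega n" "i \<noteq> j"
    and a: "a \<in> entries bar lam X i j" and x_eq: "x = T i j a"
    using x unfolding root_gens_def by blast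
  obtain k l b where kl: "k \<in> Omega n" "l \<in> Omega n" "k \<noteq> l"
    and b: "b \<in> entries bar lam Y k l" and y_eq: "y = T k l b"
    using y unfolding root_gens_def by blast
  consider "k = j \<and> l = i" | "\<not> (k = j \<and> l = i)" "k = - i \<and> l = - j"
    | "\<not> (k = j \<and> l = i)" "\<not> (k = - i \<and> l = - j)" by blast
  then show ?thesis
  proof cases
    case 1
    then show ?thesis using opposite_commutator_central[OF ij a] b x_eq y_eq by blast
  next
    case 2
    then have "l \<noteq> - k" by auto
    then have "y = T (- l) (- k) (- adj k l b)" "- adj k l b \<in> entries bar lam Y (- l) (- k)"
      using T_flip[OF kl] entry_flip[OF Y] b y_eq by auto
    then show ?thesis using opposite_commutator_central[OF ij a] 2(2) x_eq by simp
  next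
    case 3
    have "commutator G x y \<in> N"
      using chevalley_non_opposite[OF X Y ij kl 3] a b sym_prod_generate_N
      unfolding chevalley_def x_eq y_eq by blast
    then have "residue (commutator G x y) = \<one>\<^bsub>Q\<^esub>" using residue_eq_one_iff N_subset by blast
    then show ?thesis using subgroup.one_closed[OF Q.subgroup_centre] by simp
  qed
qed

lemma double_commutator_subset:
  "comm_subgroup G (comm_subgroup G (FU n bar lam X) (FU n bar lam Y)) E \<subseteq> N"
  unfolding FU_eq using root_gens_E[OF X] root_gens_E[OF Y] generator_commutator_central
  by (intro comm_subgroup_central_mod)

end

theorem theorem5:
  fixes bar :: "'a::{ring,monoid_mult} \<Rightarrow> 'a" and lam :: 'a
    and Lam I Gam J Del :: "'a set" and n :: nat
  assumes "form_ring bar lam Lam"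
    and "form_ideal bar lam Lam (I, Gam)"
    and "form_ideal bar lam Lam (J, Del)"
    and "n \<ge> 3"
  shows "comm_subgroup (GL (2 * n))
           (comm_subgroup (GL (2 * n)) (FU n bar lam (I, Gam)) (FU n bar lam (J, Del)))
           (EU_abs n bar lam Lam)
         \<subseteq> EU n bar lam Lam (sym_prod bar lam Lam (I, Gam) (J, Del))"
  unfolding EU_def normal_closure_def hull_def
proof (rule Inter_greatest)
  fix N
  assume "N \<in> {N. N \<lhd> GL (2 * n)\<lparr>carrier := EU_abs n bar lam Lam\<rparr>
    \<and> FU n bar lam (sym_prod bar lam Lam (I, Gam) (J, Del)) \<subseteq> N}"
  then have "two_form_ideals bar lam Lam n (I, Gam) (J, Del) N"
    using assms
    by (intro two_form_ideals.intro form_ring_rank.intro two_form_ideals_axioms.intro) auto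
  then show "comm_subgroup (GL (2 * n))
      (comm_subgroup (GL (2 * n)) (FU n bar lam (I, Gam)) (FU n bar lam (J, Del)))
      (EU_abs n bar lam Lam) \<subseteq> N"
    by (rule two_form_ideals.double_commutator_subset)
qed

end
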